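(* Let $G$ be a binary polyhedral group and let $[P_G(t)]_0$ be the Poincaré series of the algebra of invariants $\mathrm{Sym}(\mathbb C^2)^G$. Then $$[P_G(t)]_0=\frac{\det M_0(t)}{\det M(t)},\qquad\text{where}\qquad \det M(t)=\det|t^2I-{\bf C}_a|,\quad \det M_0(t)=\det|t^2I-{\bf C}|,$$ ${\bf C}$ is the Coxeter transformation and ${\bf C}_a$ is the corresponding affine Coxeter transformation (both related to $G$ as described in the context).
   Context: Binary polyhedral groups are the preimages, under the double covering $SU(2)\to SO(3,\mathbb R)$, of the finite subgroups of $SO(3,\mathbb R)$. $G$ acts on $\mathrm{Sym}(\mathbb C^2)=\bigoplus_{n\ge0}\mathrm{Sym}^n(\mathbb C^2)$, and $[P_G(t)]_0=\sum_{n\ge0}\dim\big(\mathrm{Sym}^n(\mathbb C^2)^G\big)t^n$. McKay correspondence: if $\rho_0$ (trivial), $\rho_1,\dots,\rho_r$ are the irreducible complex representations of $G$, $\rho$ is the faithful two-dimensional representation given by $G\subset SU(2)$, and $A=(a_{jk})$ is defined by $\rho\otimes\rho_j=\bigoplus_k a_{jk}\rho_k$, then $2I-A$ is the Cartan matrix of a simply-laced extended Dynkin diagram; deleting the vertex of $\rho_0$ gives the corresponding Dynkin diagram. ${\bf C}_a$ is the Coxeter transformation of this extended Dynkin diagram, and ${\bf C}$ is the Coxeter transformation of the Dynkin diagram. A Coxeter transformation of a diagram with Cartan matrix $K$ is the product of all simple reflections $\sigma_v(z)=z-(Kz)_v\alpha_v$, each taken once ($\alpha_v$ is the simple root of the vertex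 $v$). For a tree all such products are conjugate. The representative used is $w_1w_2$, where the vertices are split into two classes so that every edge joins different classes, and $w_i$ is the product of the (commuting) reflections of the $i$-th class. *)

theory Defs
  imports
    "Jordan_Normal_Form.Schur_Decomposition"
    "Jordan_Normal_Form.VS_Connect"
    "HOL-Computational_Algebra.Polynomial_FPS"
begin

section \<open>Binary polyhedral groups\<close>

definition SU2 :: "complex mat monoid" where
  "SU2 = \<lparr>carrier = {U \<in> carrier_mat 2 2. U * mat_adjoint U = 1\<^sub>m 2 \<and> det U = 1},
          monoid.mult = (*), one = 1\<^sub>m 2\<rparr>"

definition SO3 :: "real mat monoid" where
  "SO3 = \<lparr>carrier = {R \<in> carrier_mat 3 3. R * transpose_mat R = 1\<^sub>m 3 \<and> det R = 1},
          monoid.mult = (*), one = 1\<^sub>m 3\<rparr>"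

definition pauli :: "nat \<Rightarrow> complex mat" where
  "pauli i = [mat_of_rows_list 2 [[0, 1], [1, 0]],
              mat_of_rows_list 2 [[0, - \<i>], [\<i>, 0]],
              mat_of_rows_list 2 [[1, 0], [0, - 1]]] ! i"

definition mat_trace :: "'a::comm_monoid_add mat \<Rightarrow> 'a" where
  "mat_trace A = (\<Sum>i<dim_row A. A $$ (i, i))"

text \<open>The double covering sends \<open>U\<close> to the matrix of \<open>X \<mapsto> U X U\<^sup>*\<close> on the Euclidean
  3-space of traceless Hermitian \<open>2 \<times> 2\<close> matrices, in the basis of the Pauli matrices;
  this basis is orthonormal for the inner product \<open>tr (X Y) / 2\<close>.\<close>

definition double_cover :: "complex mat \<Rightarrow> real mat" where
  "double_cover U =
     mat 3 3 (\<lambda>(i, j). Re (mat_trace (pauli i * (U * pauli j * mat_adjoint U))) / 2)"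

definition binary_polyhedral :: "complex mat set \<Rightarrow> bool" where
  "binary_polyhedral G \<longleftrightarrow>
     (\<exists>H. subgroup H SO3 \<and> finite H \<and> G = {U \<in> carrier SU2. double_cover U \<in> H})"

section \<open>Matrix representations\<close>

definition GL :: "nat \<Rightarrow> complex mat monoid" where
  "GL n = \<lparr>carrier = {T \<in> carrier_mat n n. invertible_mat T}, monoid.mult = (*), one = 1\<^sub>m n\<rparr>"

definition representation ::
  "complex mat set \<Rightarrow> nat \<Rightarrow> (complex mat \<Rightarrow> complex mat) \<Rightarrow> bool" where
  "representation G n \<rho> \<longleftrightarrow> \<rho> \<in> hom (SU2\<lparr>carrier := G\<rparr>) (GL n)"

definition irreducible_rep ::
  "complex mat set \<Rightarrow> nat \<Rightarrow> (complex mat \<Rightarrow> complex mat) \<Rightarrow> bool" where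
  "irreducible_rep G n \<rho> \<longleftrightarrow> representation G n \<rho> \<and> n > 0 \<and>
     (\<forall>W. VectorSpace.subspace class_ring W (module_vec TYPE(complex) n) \<and>
          (\<forall>g\<in>G. \<forall>w\<in>W. \<rho> g *\<^sub>v w \<in> W) \<longrightarrow> W = {0\<^sub>v n} \<or> W = carrier_vec n)"

definition equivalent_rep ::
  "complex mat set \<Rightarrow> nat \<Rightarrow> (complex mat \<Rightarrow> complex mat) \<Rightarrow> (complex mat \<Rightarrow> complex mat) \<Rightarrow> bool"
  where
  "equivalent_rep G n \<rho> \<sigma> \<longleftrightarrow> representation G n \<rho> \<and> representation G n \<sigma> \<and>
     (\<exists>T\<in>carrier (GL n). \<forall>g\<in>G. T * \<rho> g = \<sigma> g * T)"

text \<open>\<open>\<rho> 0, \<dots>, \<rho> r\<close>, of degrees \<open>d 0, \<dots>, d r\<close>, are the irreducible complex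
  representations of \<open>G\<close>, each equivalence class listed exactly once, the trivial one first.\<close>

definition irreps_of ::
  "complex mat set \<Rightarrow> nat \<Rightarrow> (nat \<Rightarrow> nat) \<Rightarrow> (nat \<Rightarrow> complex mat \<Rightarrow> complex mat) \<Rightarrow> bool" where
  "irreps_of G r d \<rho> \<longleftrightarrow>
     (\<forall>j\<le>r. irreducible_rep G (d j) (\<rho> j)) \<and>
     (\<forall>n \<sigma>. irreducible_rep G n \<sigma> \<longrightarrow>
        (\<exists>!j. j \<le> r \<and> n = d j \<and> equivalent_rep G n \<sigma> (\<rho> j))) \<and>
     d 0 = 1 \<and> (\<forall>g\<in>G. \<rho> 0 g = 1\<^sub>m 1)"

definition kronecker :: "'a::times mat \<Rightarrow> 'a mat \<Rightarrow> 'a mat" where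
  "kronecker A B = mat (dim_row A * dim_row B) (dim_col A * dim_col B)
     (\<lambda>(i, j). A $$ (i div dim_row B, j div dim_col B) * B $$ (i mod dim_row B, j mod dim_col B))"

definition direct_sum_rep ::
  "nat \<Rightarrow> (nat \<Rightarrow> nat) \<Rightarrow> (nat \<Rightarrow> complex mat \<Rightarrow> complex mat) \<Rightarrow> complex mat \<Rightarrow> complex mat" where
  "direct_sum_rep r m \<rho> g = diag_block_mat (concat (map (\<lambda>k. replicate (m k) (\<rho> k g)) [0..<Suc r]))"

text \<open>The tensor factor \<open>\<rho>\<close> of the McKay correspondence is the inclusion
  \<open>G \<subseteq> SU(2)\<close>, i.e. \<open>g \<mapsto> g\<close>.\<close>

definition mckay_multiplicities ::
  "complex mat set \<Rightarrow> nat \<Rightarrow> (nat \<Rightarrow> nat) \<Rightarrow> (nat \<Rightarrow> complex mat \<Rightarrow> complex mat) \<Rightarrow>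
   (nat \<Rightarrow> nat \<Rightarrow> nat) \<Rightarrow> bool" where
  "mckay_multiplicities G r d \<rho> a \<longleftrightarrow>
     (\<forall>j\<le>r. equivalent_rep G (2 * d j) (\<lambda>g. kronecker g (\<rho> j g)) (direct_sum_rep r (a j) \<rho>))"

definition affine_cartan_matrix :: "nat \<Rightarrow> (nat \<Rightarrow> nat \<Rightarrow> nat) \<Rightarrow> real mat" where
  "affine_cartan_matrix r a =
     2 \<cdot>\<^sub>m 1\<^sub>m (Suc r) - mat (Suc r) (Suc r) (\<lambda>(j, k). real (a j k))"

definition cartan_matrix :: "nat \<Rightarrow> (nat \<Rightarrow> nat \<Rightarrow> nat) \<Rightarrow> real mat" where
  "cartan_matrix r a = mat_delete (affine_cartan_matrix r a) 0 0"

section \<open>Coxeter transformations\<close>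

definition simple_reflection :: "'a::comm_ring_1 mat \<Rightarrow> nat \<Rightarrow> 'a mat" where
  "simple_reflection K v =
     1\<^sub>m (dim_row K) - mat (dim_row K) (dim_row K) (\<lambda>(i, j). if i = v then K $$ (v, j) else 0)"

lemma simple_reflection_mult_vec:
  assumes "K \<in> carrier_mat n n" "v < n" "z \<in> carrier_vec n"
  shows "simple_reflection K v *\<^sub>v z = z - ((K *\<^sub>v z) $ v) \<cdot>\<^sub>v unit_vec n v"
proof (rule eq_vecI)
  fix i assume "i < dim_vec (z - ((K *\<^sub>v z) $ v) \<cdot>\<^sub>v unit_vec n v)"
  then have i: "i < n" using assms by simp
  have "(simple_reflection K v *\<^sub>v z) $ i =
      (\<Sum>j = 0..<n. (if i = j then z $ j else 0) - (if i = v then K $$ (v, j) * z $ j else 0))"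
    using assms i
    by (auto simp: simple_reflection_def scalar_prod_def left_diff_distrib intro!: sum.cong)
  also have "\<dots> = z $ i - (if i = v then (K *\<^sub>v z) $ v else 0)"
    using assms i by (auto simp: sum_subtractf scalar_prod_def)
  finally show "(simple_reflection K v *\<^sub>v z) $ i = (z - ((K *\<^sub>v z) $ v) \<cdot>\<^sub>v unit_vec n v) $ i"
    using assms i by (auto simp: unit_vec_def)
qed (use assms in \<open>auto simp: simple_reflection_def\<close>)

definition reflection_product :: "'a::comm_ring_1 mat \<Rightarrow> nat list \<Rightarrow> 'a mat" where
  "reflection_product K vs = foldr (\<lambda>v M. simple_reflection K v * M) vs (1\<^sub>m (dim_row K))"

definition no_inner_edges :: "'a::comm_ring_1 mat \<Rightarrow> nat set \<Rightarrow> bool" where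
  "no_inner_edges K V \<longleftrightarrow> (\<forall>u\<in>V. \<forall>v\<in>V. u \<noteq> v \<longrightarrow> K $$ (u, v) = 0)"

text \<open>\<open>C\<close> is the product \<open>w\<^sub>1 w\<^sub>2\<close> for some splitting of the vertices \<open>0, \<dots>, n - 1\<close> into
  two classes; \<open>vs\<close> and \<open>ws\<close> enumerate the classes.\<close>

definition coxeter_transformation :: "'a::comm_ring_1 mat \<Rightarrow> 'a mat \<Rightarrow> bool" where
  "coxeter_transformation K C \<longleftrightarrow>
     (\<exists>vs ws. distinct (vs @ ws) \<and> set (vs @ ws) = {..<dim_row K} \<and>
        no_inner_edges K (set vs) \<and> no_inner_edges K (set ws) \<and>
        C = reflection_product K vs * reflection_product K ws)"

text \<open>\<open>det |t\<^sup>2 I - C|\<close> as a polynomial in \<open>t\<close>\<close>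

definition det_t2 :: "'a::comm_ring_1 mat \<Rightarrow> 'a poly" where
  "det_t2 C = det (monom 1 2 \<cdot>\<^sub>m 1\<^sub>m (dim_row C) - map_mat (\<lambda>c. [:c:]) C)"

section \<open>Invariants of the symmetric algebra\<close>

text \<open>\<open>Sym(\<complex>\<^sup>2)\<close> is the polynomial algebra \<open>\<complex>[x, y]\<close> on the standard basis \<open>x, y\<close> of \<open>\<complex>\<^sup>2\<close>,
  represented by the type \<open>complex poly poly\<close> with inner variable \<open>x\<close> and outer variable \<open>y\<close>.\<close>

abbreviation bivariate_coeff :: "complex poly poly \<Rightarrow> nat \<Rightarrow> nat \<Rightarrow> complex" where
  "bivariate_coeff f i j \<equiv> coeff (coeff f j) i"

abbreviation bivariate_scale :: "complex \<Rightarrow> complex poly poly \<Rightarrow> complex poly poly" where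
  "bivariate_scale c f \<equiv> smult [:c:] f"

definition sym_x :: "complex poly poly" where "sym_x = [:[:0, 1:]:]"
definition sym_y :: "complex poly poly" where "sym_y = [:0, 1:]"

definition sym_power :: "nat \<Rightarrow> complex poly poly set" where
  "sym_power n = {f. \<forall>i j. bivariate_coeff f i j \<noteq> 0 \<longrightarrow> i + j = n}"

text \<open>The algebra endomorphism extending the linear map \<open>U\<close> of \<open>\<complex>\<^sup>2\<close>: it replaces \<open>x\<close> and \<open>y\<close>
  by their images, which are given by the columns of \<open>U\<close>.\<close>

definition sym_action :: "complex mat \<Rightarrow> complex poly poly \<Rightarrow> complex poly poly" where
  "sym_action U f =
     (let x' = bivariate_scale (U $$ (0, 0)) sym_x + bivariate_scale (U $$ (1, 0)) sym_y;
          y' = bivariate_scale (U $$ (0, 1)) sym_x + bivariate_scale (U $$ (1, 1)) sym_y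
      in \<Sum>j\<le>degree f. \<Sum>i\<le>degree (coeff f j).
           bivariate_scale (bivariate_coeff f i j) (x' ^ i * y' ^ j))"

definition sym_invariants :: "complex mat set \<Rightarrow> nat \<Rightarrow> complex poly poly set" where
  "sym_invariants G n = {f \<in> sym_power n. \<forall>g\<in>G. sym_action g f = f}"

definition poincare_series_0 :: "complex mat set \<Rightarrow> real fps" where
  "poincare_series_0 G =
     Abs_fps (\<lambda>n. real (vector_space.dim bivariate_scale (sym_invariants G n)))"

end

theory Submission
  imports Defs
begin

text \<open>Let \<open>\<chi>\<^sub>n\<close> be the character of \<open>Sym\<^sup>n(\<complex>\<^sup>2)\<close> and \<open>\<psi>\<^sub>k\<close> that of \<open>\<rho>\<^sub>k\<close>, and put
\<open>u\<^sub>n(k) = 1/|G| * (\<Sum>g\<in>G. \<chi>\<^sub>n(g) \<psi>\<^sub>k(g))\<close>, the dimension of the invariants of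
\<open>Sym\<^sup>n(\<complex>\<^sup>2) \<otimes> \<rho>\<^sub>k\<close>. For \<open>k = 0\<close> this is the coefficient of \<open>t\<^sup>n\<close> in the Poincare series,
because averaging over \<open>G\<close> is a projection onto the invariants and the trace of a projection
is the dimension of its image (\<open>dim_sym_invariants\<close>).

On \<open>SU(2)\<close> one has \<open>\<chi>\<^sub>1 \<chi>\<^sub>n = \<chi>\<^sub>n\<^sub>+\<^sub>1 + \<chi>\<^sub>n\<^sub>-\<^sub>1\<close> (\<open>mat_trace_sym_power_recurrence\<close>), and taking traces in
the McKay decomposition gives \<open>\<chi>\<^sub>1 \<psi>\<^sub>k = (\<Sum>j. a\<^sub>k\<^sub>j \<psi>\<^sub>j)\<close> (\<open>mckay_character\<close>). Averaging
\<open>\<chi>\<^sub>1 \<chi>\<^sub>n \<psi>\<^sub>k\<close> in these two ways yields \<open>(\<Sum>j. a\<^sub>k\<^sub>j u\<^sub>n(j)) = u\<^sub>n\<^sub>+\<^sub>1(k) + u\<^sub>n\<^sub>-\<^sub>1(k)\<close>. Moreover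
\<open>u\<^sub>0(k)\<close> is 1 for \<open>k = 0\<close> and 0 otherwise, as a nontrivial irreducible representation has no
nonzero fixed vector. Hence the vector \<open>F\<close> of generating functions \<open>\<Sum>n. u\<^sub>n(k) t\<^sup>n\<close> solves
\<open>((1 + t\<^sup>2) I - t A) F = e\<^sub>0\<close>, and Cramer's rule expresses \<open>F\<^sub>0\<close> as the quotient of the principal
minor without the vertex 0 by the full determinant (\<open>generating_function_quantum_cartan\<close>).

It remains to see that \<open>det ((1 + t\<^sup>2) I - t A) = det (t\<^sup>2 I - w\<^sub>1 w\<^sub>2)\<close> for the Coxeter
transformation \<open>w\<^sub>1 w\<^sub>2\<close> of \<open>2 I - A\<close>, and likewise for the minor. This is linear algebra of
\<open>2 \<times> 2\<close> block matrices, valid as soon as the Cartan matrix has diagonal entries 2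
(\<open>det_t2_coxeter_transformation\<close>). That \<open>A\<close> has zero diagonal follows from \<open>- 1 \<in> G\<close>: this central
element acts on every \<open>\<rho>\<^sub>j\<close> by a sign and on \<open>\<complex>\<^sup>2 \<otimes> \<rho>\<^sub>j\<close> by the opposite sign
(\<open>mckay_no_loop\<close>).\<close>

section \<open>Coxeter polynomials as determinants of deformed Cartan matrices\<close>

text \<open>Reflections of pairwise non-adjacent vertices do not interact: the reflection of \<open>v\<close> changes only
the coordinate \<open>v\<close>, and it reads none of the coordinates changed by the others, since row \<open>v\<close> of
\<open>K\<close> vanishes there.\<close>

lemma reflection_product_eq:
  assumes K: "K \<in> carrier_mat n n" and "distinct vs" "set vs \<subseteq> {..<n}" "no_inner_edges K (set vs)"
  shows "reflection_product K vs =
    mat n n (\<lambda>(i, j). (if i = j then 1 else 0) - (if i \<in> set vs then K $$ (i, j) else 0))"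
  using assms(2-)
proof (induction vs)
  case Nil
  then show ?case using K by (auto simp: reflection_product_def)
next
  case (Cons v vs)
  let ?M = "mat n n (\<lambda>(i, j). (if i = j then 1 else 0) - (if i \<in> set vs then K $$ (i, j) else 0))"
  have v: "v < n" "v \<notin> set vs" using Cons.prems by auto
  have noe: "K $$ (v, l) = 0" if "l \<in> set vs" for l
    using Cons.prems that v by (auto simp: no_inner_edges_def)
  have IH: "reflection_product K vs = ?M"
    using Cons by (auto simp: no_inner_edges_def)
  have "reflection_product K (v # vs) = simple_reflection K v * ?M"
    using IH by (simp add: reflection_product_def)
  also have "\<dots> = mat n n (\<lambda>(i, j). (if i = j then 1 else 0) - (if i \<in> set (v # vs) then K $$ (i, j) else 0))"
  proof (rule eq_matI)
    fix i j assume "i < dim_row (mat n n (\<lambda>(i, j). (if i = j then 1 else 0) - (if i \<in> set (v # vs) then K $$ (i, j) else 0)))"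
      "j < dim_col (mat n n (\<lambda>(i, j). (if i = j then 1 else 0) - (if i \<in> set (v # vs) then K $$ (i, j) else 0)))"
    then have i: "i < n" and j: "j < n" by auto
    have "(simple_reflection K v * ?M) $$ (i, j) =
        (\<Sum>l = 0..<n. ((if i = l then 1 else 0) - (if i = v then K $$ (v, l) else 0)) * ?M $$ (l, j))"
      using K i j by (simp add: simple_reflection_def scalar_prod_def)
    also have "\<dots> = (\<Sum>l = 0..<n. (if i = l then ?M $$ (l, j) else 0))
        - (\<Sum>l = 0..<n. (if i = v then K $$ (v, l) * ?M $$ (l, j) else 0))"
      unfolding sum_subtractf[symmetric] by (rule sum.cong) (auto simp: left_diff_distrib)
    also have "(\<Sum>l = 0..<n. (if i = l then ?M $$ (l, j) else 0)) = ?M $$ (i, j)"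
      using i by simp
    also have "(\<Sum>l = 0..<n. (if i = v then K $$ (v, l) * ?M $$ (l, j) else 0)) =
        (\<Sum>l = 0..<n. (if l = j then (if i = v then K $$ (v, j) else 0) else 0))"
      by (rule sum.cong) (use noe j in auto)
    also have "\<dots> = (if i = v then K $$ (v, j) else 0)"
      using j by simp
    finally show "(simple_reflection K v * ?M) $$ (i, j) =
      mat n n (\<lambda>(i, j). (if i = j then 1 else 0) - (if i \<in> set (v # vs) then K $$ (i, j) else 0)) $$ (i, j)"
      using i j v by auto
  qed (use K in \<open>auto simp: simple_reflection_def\<close>)
  finally show ?case .
qed

text \<open>This is \<open>t\<close> times the Cartan matrix whose diagonal entries 2 are replaced by \<open>t + 1/t\<close>; for
\<open>K = 2 I - A\<close> it is \<open>(1 + t\<^sup>2) I - t A\<close>.\<close>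

definition quantum_cartan :: "real mat \<Rightarrow> real poly mat" where
  "quantum_cartan K =
     mat (dim_row K) (dim_row K) (\<lambda>(i, j). if i = j then [:1, 0, 1:] else [:0, K $$ (i, j):])"

text \<open>The matrix \<open>U = 1 + N\<close> is block unipotent for the splitting of the indices by \<open>P\<close>. Since the
indices of \<open>P\<close> need not come first, \<open>U\<close> is not triangular. Instead, \<open>N\<^sup>2 = 0\<close> gives
\<open>U\<^sup>2 = 1 + 2 N\<close>, which is conjugate to \<open>U\<close> by the diagonal matrix that scales the indices in \<open>P\<close>
by 2; so \<open>det U = (det U)\<^sup>2\<close>, and \<open>det U\<close> is nonzero because \<open>1 - N\<close> inverts \<open>U\<close>.\<close>

lemma det_unipotent_block:
  fixes N :: "nat \<Rightarrow> nat \<Rightarrow> 'a :: {idom, ring_char_0}"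
  assumes off: "\<And>i j. i < n \<Longrightarrow> j < n \<Longrightarrow> N i j \<noteq> 0 \<Longrightarrow> i \<in> P \<and> j \<notin> P"
  shows "det (mat n n (\<lambda>(i, j). (if i = j then 1 else 0) + N i j)) = 1"
proof -
  define U where "U = mat n n (\<lambda>(i, j). (if i = j then 1 else 0) + N i j)"
  define V where "V = mat n n (\<lambda>(i, j). (if i = j then 1 else 0) - N i j)"
  define f where "f i = (if i \<in> P then 2 else 1 :: 'a)" for i
  define F where "F = mat_diag n f"
  have car: "U \<in> carrier_mat n n" "V \<in> carrier_mat n n" "F \<in> carrier_mat n n"
    by (auto simp: U_def V_def F_def mat_diag_def)
  have NN: "N i l * N l j = 0" if "i < n" "l < n" "j < n" for i l j
    using off[of i l] off[of l j] that by (cases "N i l = 0 \<or> N l j = 0") auto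
  have UV: "U * V = 1\<^sub>m n"
  proof (rule eq_matI)
    fix i j assume "i < dim_row (1\<^sub>m n)" "j < dim_col (1\<^sub>m n)"
    then have i: "i < n" and j: "j < n" by auto
    have "(U * V) $$ (i, j) = (\<Sum>l = 0..<n. ((if i = l then 1 else 0) + N i l) * ((if l = j then 1 else 0) - N l j))"
      using i j by (simp add: U_def V_def scalar_prod_def)
    also have "\<dots> = (\<Sum>l = 0..<n. (if l = i then (if i = j then 1 else 0) - N i j else 0) + (if l = j then N i j else 0))"
      by (rule sum.cong) (use NN[OF i _ j] in \<open>auto simp: algebra_simps\<close>)
    also have "\<dots> = (if i = j then 1 else 0)" using i j by (simp add: sum.distrib)
    finally show "(U * V) $$ (i, j) = 1\<^sub>m n $$ (i, j)" using i j by simp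
  qed (auto simp: U_def V_def)
  have UU: "U * U = mat n n (\<lambda>(i, j). (if i = j then 1 else 0) + 2 * N i j)"
  proof (rule eq_matI)
    fix i j assume "i < dim_row (mat n n (\<lambda>(i, j). (if i = j then 1 else 0) + 2 * N i j))"
      "j < dim_col (mat n n (\<lambda>(i, j). (if i = j then 1 else 0) + 2 * N i j))"
    then have i: "i < n" and j: "j < n" by auto
    have "(U * U) $$ (i, j) = (\<Sum>k = 0..<n. ((if i = k then 1 else 0) + N i k) * ((if k = j then 1 else 0) + N k j))"
      using i j by (simp add: U_def scalar_prod_def)
    also have "\<dots> = (\<Sum>k = 0..<n. (if k = i then (if i = j then 1 else 0) + N i j else 0) + (if k = j then N i j else 0))"
      by (rule sum.cong) (use NN[OF i _ j] in \<open>auto simp: algebra_simps\<close>)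
    also have "\<dots> = (if i = j then 1 else 0) + 2 * N i j" using i j by (simp add: sum.distrib)
    finally show "(U * U) $$ (i, j) = mat n n (\<lambda>(i, j). (if i = j then 1 else 0) + 2 * N i j) $$ (i, j)"
      using i j by simp
  qed (auto simp: U_def)
  have FU: "F * U = (U * U) * F"
    unfolding UU F_def mat_diag_mult_left[OF car(1)] mat_diag_mult_right[OF mat_carrier]
    by (rule cong_mat) (use off in \<open>force simp: U_def f_def\<close>)+
  have "det F = (\<Prod>i = 0..<n. F $$ (i, i))"
    using det_upper_triangular[of F n] car by (simp add: prod_list_diag_prod F_def mat_diag_def upper_triangular_def)
  also have "\<dots> \<noteq> 0" by (auto simp: F_def mat_diag_def f_def)
  finally have F0: "det F \<noteq> 0" .
  have "det U * det V = 1" using UV det_mult[OF car(1,2)] by simp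
  then have U0: "det U \<noteq> 0" by auto
  have "det F * det U = det U * det U * det F"
    using arg_cong[OF FU, of det] car by (simp add: det_mult)
  then have "det U = 1" using F0 U0 by simp
  then show ?thesis by (simp add: U_def)
qed

lemma const_poly_sum: "[:sum f A:] = (\<Sum>x\<in>A. [:f x:])"
  by (induction A rule: infinite_finite_induct) (simp_all, metis add_pCons add_0)

text \<open>Let \<open>P\<close> be the first class of vertices. With the vertices in \<open>P\<close> written first, let \<open>- B\<close> and
\<open>- B'\<close> be the off-diagonal blocks of \<open>K\<close>. Then \<open>w\<^sub>1 = [[- 1, B], [0, 1]]\<close>, \<open>w\<^sub>2 = [[1, 0], [B', - 1]]\<close> and
\<open>t\<^sup>2 - w\<^sub>1 w\<^sub>2 = [[t\<^sup>2 + 1 - B B', B], [- B', t\<^sup>2 + 1]] = U X\<close> with \<open>U = [[1, B], [0, 1]]\<close> and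
\<open>X = [[t\<^sup>2 + 1, - t\<^sup>2 B], [- B', t\<^sup>2 + 1]]\<close>. Here \<open>det U = 1\<close>, and conjugation with the diagonal
matrix that is \<open>t\<close> on \<open>P\<close> and 1 elsewhere turns \<open>X\<close> into the deformed Cartan matrix.\<close>

lemma det_t2_coxeter_transformation:
  assumes K: "K \<in> carrier_mat n n" and diag: "\<And>v. v < n \<Longrightarrow> K $$ (v, v) = 2"
    and cox: "coxeter_transformation K C"
  shows "det_t2 C = det (quantum_cartan K)"
proof -
  from cox K obtain vs ws where dist: "distinct (vs @ ws)" and all: "set (vs @ ws) = {..<n}"
    and nvs: "no_inner_edges K (set vs)" and nws: "no_inner_edges K (set ws)"
    and C: "C = reflection_product K vs * reflection_product K ws"
    by (auto simp: coxeter_transformation_def)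
  define P where "P = set vs"
  have Q: "j \<in> set ws \<longleftrightarrow> j \<notin> P" if "j < n" for j
    using dist all that by (auto simp: P_def)
  have PP: "K $$ (i, j) = 0" if "i \<in> P" "j \<in> P" "i \<noteq> j" for i j
    using nvs that by (auto simp: P_def no_inner_edges_def)
  have QQ: "K $$ (i, j) = 0" if "i \<notin> P" "j \<notin> P" "i \<noteq> j" "i < n" "j < n" for i j
    using nws that Q by (auto simp: no_inner_edges_def)
  define W1 where "W1 = mat n n (\<lambda>(i, j). (if i = j then 1 else 0) - (if i \<in> P then K $$ (i, j) else 0))"
  define W2 where "W2 = mat n n (\<lambda>(i, j). (if i = j then 1 else 0) - (if i \<notin> P then K $$ (i, j) else 0))"
  have "reflection_product K vs = W1"
    unfolding W1_def P_def by (rule reflection_product_eq[OF K]) (use dist all nvs in auto)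
  moreover have "reflection_product K ws = W2"
    unfolding W2_def
    by (subst reflection_product_eq[OF K]) (use dist all nws Q in \<open>auto intro!: cong_mat\<close>)
  ultimately have C: "C = W1 * W2" using C by simp
  let ?t = "monom (1::real) 1"
  define U where "U = mat n n (\<lambda>(i, j). (if i = j then 1 else 0) +
     (if i \<in> P \<and> j \<notin> P then [:- (K $$ (i, j)):] else 0))"
  define X where "X = mat n n (\<lambda>(i, j). if i = j then [:1, 0, 1:]
     else if i \<in> P then [:0, 0, K $$ (i, j):] else [:K $$ (i, j):])"
  define e where "e i = (if i \<in> P then ?t else 1)" for i
  define D where "D = mat_diag n e"
  have car: "U \<in> carrier_mat n n" "X \<in> carrier_mat n n" "D \<in> carrier_mat n n" "quantum_cartan K \<in> carrier_mat n n"
    using K by (auto simp: U_def X_def D_def mat_diag_def quantum_cartan_def)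
  have Ccar: "C \<in> carrier_mat n n" unfolding C by (auto simp: W1_def W2_def)
  have UX: "monom 1 2 \<cdot>\<^sub>m 1\<^sub>m (dim_row C) - map_mat (\<lambda>c. [:c:]) C = U * X"
  proof (rule eq_matI)
    fix i j assume "i < dim_row (U * X)" "j < dim_col (U * X)"
    then have i: "i < n" and j: "j < n" using car by auto
    have Cij: "C $$ (i, j) = (\<Sum>l = 0..<n. W1 $$ (i, l) * W2 $$ (l, j))"
      unfolding C using i j by (simp add: W1_def W2_def scalar_prod_def)
    have UXij: "(U * X) $$ (i, j) = (\<Sum>l = 0..<n. U $$ (i, l) * X $$ (l, j))"
      using i j car by (simp add: scalar_prod_def)
    \<comment> \<open>Apart from \<open>l = i\<close>, only \<open>i \<in> P\<close> and \<open>l \<notin> P\<close> can contribute; there the contributions of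
      the entry \<open>(l, j)\<close> of \<open>K\<close> to the two products cancel for \<open>l \<noteq> j\<close>.\<close>
    have termwise: "U $$ (i, l) * X $$ (l, j) + [:W1 $$ (i, l) * W2 $$ (l, j):] =
        (if l = i then X $$ (i, j) + [:W1 $$ (i, i) * W2 $$ (i, j):] else 0) +
        (if l = j then (if i \<in> P \<and> j \<notin> P then [:0, 0, - (K $$ (i, j)):] else 0) else 0)"
      if l: "l < n" for l
      using i j l PP[of i l] diag by (auto simp: U_def X_def W1_def W2_def)
    have "(U * X) $$ (i, j) + [:C $$ (i, j):] =
        (\<Sum>l = 0..<n. U $$ (i, l) * X $$ (l, j) + [:W1 $$ (i, l) * W2 $$ (l, j):])"
      unfolding UXij Cij sum.distrib by (simp add: const_poly_sum)
    also have "\<dots> = X $$ (i, j) + [:W1 $$ (i, i) * W2 $$ (i, j):] +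
        (if i \<in> P \<and> j \<notin> P then [:0, 0, - (K $$ (i, j)):] else 0)"
      using i j by (simp add: termwise sum.distrib del: sum.delta')
    also have "\<dots> = (if i = j then monom 1 2 else 0)"
      using i j PP[of i j] diag by (auto simp: X_def W1_def W2_def monom_altdef power2_eq_square)
    finally have "(U * X) $$ (i, j) = (if i = j then monom 1 2 else 0) - [:C $$ (i, j):]"
      by (simp add: eq_diff_eq)
    then show "(monom 1 2 \<cdot>\<^sub>m 1\<^sub>m (dim_row C) - map_mat (\<lambda>c. [:c:]) C) $$ (i, j) = (U * X) $$ (i, j)"
      using i j Ccar by auto
  qed (use Ccar car in auto)
  have DX: "X * D = D * quantum_cartan K"
    unfolding D_def mat_diag_mult_left[OF car(4)] mat_diag_mult_right[OF car(2)]
  proof (rule cong_mat)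
    fix i j assume "i < n" "j < n"
    then show "(case (i, j) of (i, j) \<Rightarrow> X $$ (i, j) * e j) = (case (i, j) of (i, j) \<Rightarrow> e i * quantum_cartan K $$ (i, j))"
      using K PP[of i j] QQ[of i j] by (auto simp: X_def e_def quantum_cartan_def monom_altdef)
  qed auto
  have "det D = (\<Prod>i = 0..<n. D $$ (i, i))"
    using det_upper_triangular[of D n] car by (simp add: prod_list_diag_prod D_def mat_diag_def upper_triangular_def)
  also have "\<dots> \<noteq> 0" by (auto simp: D_def mat_diag_def e_def)
  finally have D0: "det D \<noteq> 0" .
  have "det X = det (quantum_cartan K)"
    using arg_cong[OF DX, of det] car D0 by (simp add: det_mult)
  moreover have "det U = 1"
    unfolding U_def by (rule det_unipotent_block[where P = P]) (auto split: if_splits)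
  ultimately show ?thesis
    unfolding det_t2_def UX using car by (simp add: det_mult)
qed

lemma mat_delete_quantum_cartan:
  assumes "K \<in> carrier_mat (Suc n) (Suc n)"
  shows "mat_delete (quantum_cartan K) 0 0 = quantum_cartan (mat_delete K 0 0)"
  using assms by (intro eq_matI) (auto simp: mat_delete_def quantum_cartan_def)

section \<open>Generating functions by Cramer's rule\<close>

text \<open>Cramer's rule for the right-hand side \<open>e\<^sub>0\<close>, read off from the row 0 of the adjugate. Stated
without division, it holds over the ring of formal power series.\<close>

lemma det_mult_solution_unit_vec:
  fixes M :: "'a :: comm_ring_1 mat"
  assumes M: "M \<in> carrier_mat (Suc r) (Suc r)" and f: "f \<in> carrier_vec (Suc r)"
    and sol: "M *\<^sub>v f = unit_vec (Suc r) 0"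
  shows "det M * f $ 0 = det (mat_delete M 0 0)"
proof -
  have "det M \<cdot>\<^sub>v f = (adj_mat M * M) *\<^sub>v f"
    using adj_mat(3)[OF M] f by (intro eq_vecI) (auto simp: row_smult)
  also have "\<dots> = adj_mat M *\<^sub>v unit_vec (Suc r) 0"
    using adj_mat(1)[OF M] M f sol by (simp add: assoc_mult_mat_vec)
  finally have "(det M \<cdot>\<^sub>v f) $ 0 = (adj_mat M *\<^sub>v unit_vec (Suc r) 0) $ 0" by simp
  also have "\<dots> = adj_mat M $$ (0, 0)"
    using adj_mat(1)[OF M] by (simp add: scalar_prod_right_unit)
  also have "\<dots> = det (mat_delete M 0 0)"
    using M by (simp add: adj_mat_def cofactor_def)
  finally show ?thesis using f by simp
qed

lemma fps_of_poly_det: "fps_of_poly (det M) = det (map_mat fps_of_poly M)"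
proof -
  interpret fps_of_poly_hom: comm_ring_hom fps_of_poly
    by unfold_locales (simp_all add: fps_of_poly_add fps_of_poly_mult)
  show ?thesis by simp
qed

text \<open>The recurrence and the initial values say that the vector of the generating functions
\<open>\<Sum>n. u\<^sub>n(k) t\<^sup>n\<close> is mapped to \<open>e\<^sub>0\<close> by \<open>(1 + t\<^sup>2) I - t A\<close>.\<close>

lemma generating_function_quantum_cartan:
  fixes a :: "nat \<Rightarrow> nat \<Rightarrow> nat" and u :: "nat \<Rightarrow> nat \<Rightarrow> real"
  assumes diag: "\<And>k. k \<le> r \<Longrightarrow> a k k = 0"
    and init: "\<And>k. k \<le> r \<Longrightarrow> u 0 k = (if k = 0 then 1 else 0)"
    and step: "\<And>n k. k \<le> r \<Longrightarrow>
      (\<Sum>j\<le>r. real (a k j) * u n j) = u (Suc n) k + (if n = 0 then 0 else u (n - 1) k)"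
  shows "fps_of_poly (det (quantum_cartan (affine_cartan_matrix r a))) * Abs_fps (\<lambda>n. u n 0) =
    fps_of_poly (det (quantum_cartan (cartan_matrix r a)))"
proof -
  let ?K = "affine_cartan_matrix r a"
  let ?M = "map_mat fps_of_poly (quantum_cartan ?K)"
  define F where "F k = Abs_fps (\<lambda>n. u n k)" for k
  have K: "?K \<in> carrier_mat (Suc r) (Suc r)" by (auto simp: affine_cartan_matrix_def)
  then have M: "?M \<in> carrier_mat (Suc r) (Suc r)" by (simp add: quantum_cartan_def)
  have "?M *\<^sub>v vec (Suc r) F = unit_vec (Suc r) 0"
  proof (rule eq_vecI)
    fix k assume "k < dim_vec (unit_vec (Suc r) 0)"
    then have k: "k \<le> r" by simp
    have "(?M *\<^sub>v vec (Suc r) F) $ k = (\<Sum>j\<le>r. ?M $$ (k, j) * F j)"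
      using M k by (simp add: scalar_prod_def atLeast0LessThan lessThan_Suc_atMost del: sum.atMost_Suc sum.lessThan_Suc)
    also have "\<dots> = (\<Sum>j\<le>r. (if j = k then (1 + fps_X ^ 2) * F k else 0) - fps_X * (fps_const (real (a k j)) * F j))"
    proof (rule sum.cong)
      fix j assume "j \<in> {..r}"
      then show "?M $$ (k, j) * F j = (if j = k then (1 + fps_X ^ 2) * F k else 0) - fps_X * (fps_const (real (a k j)) * F j)"
        using k K diag by (auto simp: quantum_cartan_def affine_cartan_matrix_def fps_of_poly_pCons power2_eq_square algebra_simps simp del: fps_const_neg simp flip: fps_const_neg)
    qed simp
    also have "\<dots> = (1 + fps_X ^ 2) * F k - fps_X * (\<Sum>j\<le>r. fps_const (real (a k j)) * F j)"
      using k by (simp add: sum_subtractf sum_distrib_left)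
    also have "\<dots> = (if k = 0 then 1 else 0)"
    proof (rule fps_ext)
      fix n
      have X2: "fps_nth (fps_X ^ 2 * F k) n = (if n < 2 then 0 else u (n - 2) k)" for n
        by (simp add: fps_X_power_mult_nth F_def)
      show "fps_nth ((1 + fps_X ^ 2) * F k - fps_X * (\<Sum>j\<le>r. fps_const (real (a k j)) * F j)) n =
          fps_nth (if k = 0 then 1 else 0) n"
      proof (cases n)
        case 0
        then show ?thesis using init[OF k] by (cases "k = 0") (simp_all add: ring_distribs X2, simp_all add: F_def)
      next
        case (Suc m)
        have "fps_nth ((1 + fps_X ^ 2) * F k - fps_X * (\<Sum>j\<le>r. fps_const (real (a k j)) * F j)) n
            = u (Suc m) k + (if n < 2 then 0 else u (n - 2) k) - (\<Sum>j\<le>r. real (a k j) * u m j)"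
          using Suc by (simp add: ring_distribs fps_sum_nth X2) (auto simp: F_def)
        then show ?thesis using step[OF k, of m] Suc by (cases m) auto
      qed
    qed
    finally show "(?M *\<^sub>v vec (Suc r) F) $ k = unit_vec (Suc r) 0 $ k" using k by simp
  qed (use M in simp)
  from det_mult_solution_unit_vec[OF M _ this]
  have "det ?M * F 0 = det (mat_delete ?M 0 0)" by simp
  also have "mat_delete ?M 0 0 = map_mat fps_of_poly (mat_delete (quantum_cartan ?K) 0 0)"
    using K by (intro eq_matI) (auto simp: mat_delete_def quantum_cartan_def)
  finally show ?thesis
    using mat_delete_quantum_cartan[OF K] by (simp add: fps_of_poly_det F_def cartan_matrix_def)
qed

text \<open>At \<open>t = 0\<close> the matrix is the identity.\<close>

lemma det_quantum_cartan_nonzero: "det (quantum_cartan K) \<noteq> 0"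
proof -
  have "comm_ring_hom (\<lambda>p :: real poly. poly p 0)"
    by unfold_locales auto
  then have "poly (det (quantum_cartan K)) 0 = det (map_mat (\<lambda>p. poly p 0) (quantum_cartan K))"
    by (rule comm_ring_hom.hom_det[symmetric])
  also have "map_mat (\<lambda>p. poly p 0) (quantum_cartan K) = 1\<^sub>m (dim_row K)"
    by (rule eq_matI) (auto simp: quantum_cartan_def)
  finally show ?thesis by auto
qed

section \<open>Binary polyhedral groups\<close>

definition su2_mat :: "complex \<Rightarrow> complex \<Rightarrow> complex mat" where
  "su2_mat a b = mat_of_rows_list 2 [[a, b], [- cnj b, cnj a]]"

lemma su2_mat_simps [simp]:
  "su2_mat a b \<in> carrier_mat 2 2" "dim_row (su2_mat a b) = 2" "dim_col (su2_mat a b) = 2"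
  "su2_mat a b $$ (0, 0) = a" "su2_mat a b $$ (0, Suc 0) = b"
  "su2_mat a b $$ (Suc 0, 0) = - cnj b" "su2_mat a b $$ (Suc 0, Suc 0) = cnj a"
  by (simp_all add: su2_mat_def mat_of_rows_list_def carrier_matI)

lemma sum_below_2: "(\<Sum>i = 0..<2. f i) = f 0 + f (Suc 0)" for f :: "nat \<Rightarrow> 'a :: comm_monoid_add"
  by (simp add: numeral_2_eq_2)

lemma sum_below_3: "(\<Sum>i = 0..<3. f i) = f 0 + f (Suc 0) + f (Suc (Suc 0))" for f :: "nat \<Rightarrow> 'a :: comm_monoid_add"
  by (simp add: numeral_3_eq_3)

lemma below_2: "i < 2 \<longleftrightarrow> i = 0 \<or> i = Suc 0" by auto
lemma below_3: "i < 3 \<longleftrightarrow> i = 0 \<or> i = Suc 0 \<or> i = Suc (Suc 0)" by auto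

lemma det_2x2:
  fixes A :: "'a :: comm_ring_1 mat"
  assumes "A \<in> carrier_mat 2 2"
  shows "det A = A $$ (0, 0) * A $$ (Suc 0, Suc 0) - A $$ (0, Suc 0) * A $$ (Suc 0, 0)"
proof -
  have "det (mat_delete A 0 j) = mat_delete A 0 j $$ (0, 0)" for j
    using assms by (intro det_single) (auto simp: mat_delete_def)
  then show ?thesis
    using assms laplace_expansion_row[OF assms, of 0]
    by (simp add: cofactor_def mat_delete_def lessThan_atLeast0 sum_below_2)
qed

lemma su2_mat_mult:
  "su2_mat a b * su2_mat c d = su2_mat (a * c - b * cnj d) (a * d + b * cnj c)"
  by (rule eq_matI) (auto simp: below_2 scalar_prod_def sum_below_2 algebra_simps)

lemma mat_adjoint_index:
  "i < dim_col A \<Longrightarrow> j < dim_row A \<Longrightarrow> mat_adjoint A $$ (i, j) = conjugate (A $$ (j, i))"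
  by (simp add: mat_adjoint_def mat_of_rows_def)

lemma mat_adjoint_dim [simp]: "dim_row (mat_adjoint A) = dim_col A" "dim_col (mat_adjoint A) = dim_row A"
  by (auto simp: mat_adjoint_def mat_of_rows_def)

lemma mat_adjoint_su2_mat: "mat_adjoint (su2_mat a b) = su2_mat (cnj a) (- b)"
  by (rule eq_matI) (auto simp: below_2 mat_adjoint_index)

text \<open>Each equation for the second row is a combination of unitarity and \<open>det U = 1\<close>; equivalently,
the adjoint of \<open>U\<close> is its inverse, which is the adjugate.\<close>

lemma SU2_eq_su2_mat:
  assumes "U \<in> carrier SU2"
  shows "U = su2_mat (U $$ (0, 0)) (U $$ (0, Suc 0))"
proof -
  have U: "U \<in> carrier_mat 2 2" and un: "U * mat_adjoint U = 1\<^sub>m 2" and det: "det U = 1"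
    using assms by (auto simp: SU2_def)
  define a b c d where abcd: "a = U $$ (0, 0)" "b = U $$ (0, Suc 0)" "c = U $$ (Suc 0, 0)" "d = U $$ (Suc 0, Suc 0)"
  have entry: "(U * mat_adjoint U) $$ (i, j) = U $$ (i, 0) * cnj (U $$ (j, 0)) + U $$ (i, Suc 0) * cnj (U $$ (j, Suc 0))"
    if "i < 2" "j < 2" for i j
    using that U by (auto simp: scalar_prod_def sum_below_2 mat_adjoint_index)
  have 1: "a * cnj a + b * cnj b = 1" using entry[of 0 0] un by (simp add: abcd)
  have 2: "c * cnj a + d * cnj b = 0" using entry[of "Suc 0" 0] un by (simp add: abcd)
  have 3: "a * d - b * c = 1"
    using det det_2x2[OF U] by (simp add: abcd)
  have "d * (a * cnj a + b * cnj b) - cnj a * (a * d - b * c) = b * (c * cnj a + d * cnj b)"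
    by (simp add: algebra_simps)
  then have d: "d = cnj a" unfolding 1 2 3 by simp
  have "c * (a * cnj a + b * cnj b) + cnj b * (a * d - b * c) = a * (c * cnj a + d * cnj b)"
    by (simp add: algebra_simps)
  then have c: "c = - cnj b" unfolding 1 2 3 by (simp add: add_eq_0_iff2)
  show ?thesis
    using c d U by (intro eq_matI) (auto simp: below_2 abcd)
qed

lemma pauli_simps [simp]:
  "dim_row (pauli 0) = 2" "dim_col (pauli 0) = 2"
  "dim_row (pauli (Suc 0)) = 2" "dim_col (pauli (Suc 0)) = 2"
  "dim_row (pauli (Suc (Suc 0))) = 2" "dim_col (pauli (Suc (Suc 0))) = 2"
  "pauli 0 $$ (0, 0) = 0" "pauli 0 $$ (0, Suc 0) = 1"
  "pauli 0 $$ (Suc 0, 0) = 1" "pauli 0 $$ (Suc 0, Suc 0) = 0"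
  "pauli (Suc 0) $$ (0, 0) = 0" "pauli (Suc 0) $$ (0, Suc 0) = - \<i>"
  "pauli (Suc 0) $$ (Suc 0, 0) = \<i>" "pauli (Suc 0) $$ (Suc 0, Suc 0) = 0"
  "pauli (Suc (Suc 0)) $$ (0, 0) = 1" "pauli (Suc (Suc 0)) $$ (0, Suc 0) = 0"
  "pauli (Suc (Suc 0)) $$ (Suc 0, 0) = 0" "pauli (Suc (Suc 0)) $$ (Suc 0, Suc 0) = - 1"
  by (simp_all add: pauli_def mat_of_rows_list_def)

lemma double_cover_su2_mat:
  "double_cover (su2_mat a b) = mat 3 3 (\<lambda>(i, j).
    [[Re (a * a - b * b), Im (a * a + b * b), - 2 * Re (a * b)],
     [- Im (a * a - b * b), Re (a * a + b * b), 2 * Im (a * b)],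
     [2 * Re (a * cnj b), 2 * Im (a * cnj b), Re (a * cnj a - b * cnj b)]] ! i ! j)"
  unfolding double_cover_def mat_adjoint_su2_mat
  by (rule cong_mat)
    (auto simp: below_3 mat_trace_def lessThan_atLeast0 sum_below_2 scalar_prod_def algebra_simps)

text \<open>The entries of the rotation are quadratic forms in the real and imaginary parts of \<open>a\<close> and \<open>b\<close>,
and the nine identities are the multiplicativity of the Euler-Rodrigues parametrization.\<close>

lemma double_cover_mult:
  "double_cover (su2_mat a b * su2_mat c d) = double_cover (su2_mat a b) * double_cover (su2_mat c d)"
  unfolding su2_mat_mult double_cover_su2_mat
  by (rule eq_matI) (auto simp: below_3 scalar_prod_def sum_below_3 algebra_simps)

lemma double_cover_one: "double_cover (1\<^sub>m 2) = 1\<^sub>m 3" and double_cover_minus_one: "double_cover (- 1\<^sub>m 2) = 1\<^sub>m 3"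
proof -
  have "1\<^sub>m 2 = su2_mat 1 0" "- 1\<^sub>m 2 = su2_mat (- 1) 0"
    by (auto intro!: eq_matI simp: below_2)
  then show "double_cover (1\<^sub>m 2) = 1\<^sub>m 3" "double_cover (- 1\<^sub>m 2) = 1\<^sub>m 3"
    by (auto simp: double_cover_su2_mat below_3 mat_of_rows_list_def intro!: eq_matI)
qed

lemma finite_complex_square_roots: "finite {z :: complex. z * z = w}"
proof (rule finite_subset)
  show "{z. z * z = w} \<subseteq> {csqrt w, - csqrt w}"
    by (auto simp: power2_eq_square[symmetric]) (metis power2_csqrt power2_eq_iff)
qed simp

text \<open>The rotation determines \<open>a\<^sup>2\<close> and \<open>b\<^sup>2\<close> through its upper left \<open>2 \<times> 2\<close> block, so every fibre has
at most four elements.\<close>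

lemma finite_double_cover_vimage:
  assumes "finite H"
  shows "finite {U \<in> carrier SU2. double_cover U \<in> H}"
proof (rule finite_subset)
  define \<alpha> where "\<alpha> R = Complex ((R $$ (0, 0) + R $$ (1, 1)) / 2) ((R $$ (0, 1) - R $$ (1, 0)) / 2)" for R :: "real mat"
  define \<beta> where "\<beta> R = Complex ((R $$ (1, 1) - R $$ (0, 0)) / 2) ((R $$ (0, 1) + R $$ (1, 0)) / 2)" for R :: "real mat"
  show "{U \<in> carrier SU2. double_cover U \<in> H} \<subseteq>
      (\<Union>R\<in>H. (\<lambda>(a, b). su2_mat a b) ` ({a. a * a = \<alpha> R} \<times> {b. b * b = \<beta> R}))"
  proof
    fix U assume "U \<in> {U \<in> carrier SU2. double_cover U \<in> H}"
    then have U: "U \<in> carrier SU2" and H: "double_cover U \<in> H" by auto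
    define a b where "a = U $$ (0, 0)" and "b = U $$ (0, Suc 0)"
    have eq: "U = su2_mat a b" using SU2_eq_su2_mat[OF U] by (simp add: a_def b_def)
    have "a * a = \<alpha> (double_cover U)" "b * b = \<beta> (double_cover U)"
      unfolding eq double_cover_su2_mat
      by (auto simp: \<alpha>_def \<beta>_def mat_of_rows_list_def complex_eq_iff field_simps)
    then show "U \<in> (\<Union>R\<in>H. (\<lambda>(a, b). su2_mat a b) ` ({a. a * a = \<alpha> R} \<times> {b. b * b = \<beta> R}))"
      using H eq by blast
  qed
  show "finite (\<Union>R\<in>H. (\<lambda>(a, b). su2_mat a b) ` ({a. a * a = \<alpha> R} \<times> {b. b * b = \<beta> R}))"
    using assms finite_complex_square_roots by blast
qed

lemma SU2_mult_closed:
  assumes "U \<in> carrier SU2" "V \<in> carrier SU2"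
  shows "U * V \<in> carrier SU2" "double_cover (U * V) = double_cover U * double_cover V"
proof -
  have U: "U \<in> carrier_mat 2 2" "U * mat_adjoint U = 1\<^sub>m 2" "det U = 1"
    and V: "V \<in> carrier_mat 2 2" "V * mat_adjoint V = 1\<^sub>m 2" "det V = 1"
    using assms by (auto simp: SU2_def)
  obtain a b c d where eq: "U = su2_mat a b" "V = su2_mat c d"
    using assms SU2_eq_su2_mat by meson
  show "double_cover (U * V) = double_cover U * double_cover V"
    unfolding eq by (rule double_cover_mult)
  have adj: "mat_adjoint (U * V) = mat_adjoint V * mat_adjoint U"
    unfolding eq su2_mat_mult mat_adjoint_su2_mat by (auto simp: algebra_simps)
  have aU: "mat_adjoint U \<in> carrier_mat 2 2" and aV: "mat_adjoint V \<in> carrier_mat 2 2"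
    using U(1) V(1) by auto
  have "V * (mat_adjoint V * mat_adjoint U) = mat_adjoint U"
    using assoc_mult_mat[OF V(1) aV aU] V(2) left_mult_one_mat[OF aU] by simp
  then have "(U * V) * mat_adjoint (U * V) = 1\<^sub>m 2"
    unfolding adj using assoc_mult_mat[OF U(1) V(1) mult_carrier_mat[OF aV aU]] U(2) by simp
  then show "U * V \<in> carrier SU2"
    using U V by (auto simp: SU2_def det_mult)
qed

text \<open>The double covering is multiplicative and maps both \<open>1\<close> and \<open>- 1\<close> to the identity.\<close>

lemma binary_polyhedral_group:
  assumes "binary_polyhedral G"
  shows "finite G" "G \<subseteq> carrier SU2" "1\<^sub>m 2 \<in> G" "- 1\<^sub>m 2 \<in> G"
    "\<And>g h. g \<in> G \<Longrightarrow> h \<in> G \<Longrightarrow> g * h \<in> G"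
proof -
  obtain H where H: "subgroup H SO3" "finite H" and G: "G = {U \<in> carrier SU2. double_cover U \<in> H}"
    using assms by (auto simp: binary_polyhedral_def)
  have one: "1\<^sub>m 3 \<in> H" using subgroup.one_closed[OF H(1)] by (simp add: SO3_def)
  have mult: "R * S \<in> H" if "R \<in> H" "S \<in> H" for R S
    using subgroup.m_closed[OF H(1) that] by (simp add: SO3_def)
  show "finite G" unfolding G by (rule finite_double_cover_vimage[OF H(2)])
  show "G \<subseteq> carrier SU2" by (auto simp: G)
  have "1\<^sub>m 2 = su2_mat 1 0" and m: "- 1\<^sub>m 2 = su2_mat (- 1) 0"
    by (auto intro!: eq_matI simp: below_2)
  then have "1\<^sub>m 2 \<in> carrier SU2" "- 1\<^sub>m 2 \<in> carrier SU2"
    by (auto simp: SU2_def mat_adjoint_su2_mat su2_mat_mult det_2x2)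
  then show "1\<^sub>m 2 \<in> G" "- 1\<^sub>m 2 \<in> G"
    using one by (auto simp: G double_cover_one double_cover_minus_one)
  show "g * h \<in> G" if "g \<in> G" "h \<in> G" for g h
    using that mult SU2_mult_closed by (auto simp: G)
qed

section \<open>Characters and the McKay multiplicities\<close>

lemma mat_trace_mult_commute:
  fixes A B :: "'a :: comm_semiring_0 mat"
  assumes "A \<in> carrier_mat n m" "B \<in> carrier_mat m n"
  shows "mat_trace (A * B) = mat_trace (B * A)"
proof -
  have "mat_trace (A * B) = (\<Sum>i<n. \<Sum>j<m. A $$ (i, j) * B $$ (j, i))"
    using assms by (simp add: mat_trace_def scalar_prod_def lessThan_atLeast0)
  also have "\<dots> = (\<Sum>j<m. \<Sum>i<n. B $$ (j, i) * A $$ (i, j))"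
    by (subst sum.swap) (simp add: mult.commute)
  also have "\<dots> = mat_trace (B * A)"
    using assms by (simp add: mat_trace_def scalar_prod_def lessThan_atLeast0)
  finally show ?thesis .
qed

lemma mat_trace_one [simp]: "mat_trace (1\<^sub>m n :: 'a :: semiring_1 mat) = of_nat n"
  by (simp add: mat_trace_def)

text \<open>Equivalent representations have the same character.\<close>

lemma mat_trace_intertwined:
  fixes A B T :: "complex mat"
  assumes A: "A \<in> carrier_mat n n" and B: "B \<in> carrier_mat n n" and T: "T \<in> carrier (GL n)"
    and TA: "T * A = B * T"
  shows "mat_trace A = mat_trace B"
proof -
  have Tc: "T \<in> carrier_mat n n" and "invertible_mat T" using T by (auto simp: GL_def)
  then obtain S where TS: "T * S = 1\<^sub>m n" and ST: "S * T = 1\<^sub>m (dim_row S)"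
    by (auto simp: invertible_mat_def inverts_mat_def)
  have "dim_col S = n" using arg_cong[OF TS, of dim_col] by simp
  moreover have "dim_row S = n" using arg_cong[OF ST, of dim_col] Tc by simp
  ultimately have Sc: "S \<in> carrier_mat n n" by auto
  have "A = (S * T) * A" using ST Sc A by simp
  also have "\<dots> = S * (B * T)" using Sc Tc A B TA by (metis assoc_mult_mat)
  finally have "mat_trace A = mat_trace ((B * T) * S)"
    using mat_trace_mult_commute[of S n n "B * T"] Sc B Tc by simp
  also have "(B * T) * S = B" using assoc_mult_mat[OF B Tc Sc] TS B by simp
  finally show ?thesis .
qed

lemma sum_lessThan_add: "(\<Sum>i<n + m. f i) = (\<Sum>i<n. f i) + (\<Sum>i<m. f (n + i))"
  for f :: "nat \<Rightarrow> 'a :: comm_monoid_add"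
  by (induction m) (simp_all add: add.assoc)

lemma mat_trace_diag_block_mat:
  assumes "\<And>A. A \<in> set As \<Longrightarrow> square_mat A"
  shows "mat_trace (diag_block_mat As :: 'a :: comm_monoid_add mat) = sum_list (map mat_trace As)"
  using assms
proof (induction As)
  case Nil
  then show ?case by (simp add: mat_trace_def)
next
  case (Cons A As)
  let ?B = "diag_block_mat As"
  have "square_mat ?B" using Cons.prems by (intro diag_block_mat_square) auto
  then have sq: "dim_col A = dim_row A" "dim_col ?B = dim_row ?B" using Cons.prems by auto
  let ?n = "dim_row A" and ?m = "dim_row ?B"
  have "mat_trace (diag_block_mat (A # As)) =
      (\<Sum>i<?n + ?m. diag_block_mat (A # As) $$ (i, i))"
    by (simp add: mat_trace_def Let_def)
  also have "\<dots> = (\<Sum>i<?n. diag_block_mat (A # As) $$ (i, i)) +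
      (\<Sum>i<?m. diag_block_mat (A # As) $$ (?n + i, ?n + i))"
    by (rule sum_lessThan_add)
  also have "(\<Sum>i<?n. diag_block_mat (A # As) $$ (i, i)) = mat_trace A"
    using sq by (auto simp: mat_trace_def Let_def intro!: sum.cong)
  also have "(\<Sum>i<?m. diag_block_mat (A # As) $$ (?n + i, ?n + i)) = mat_trace ?B"
    using sq by (auto simp: mat_trace_def Let_def intro!: sum.cong)
  finally show ?case using Cons by simp
qed

lemma sum_list_map_concat_replicate:
  fixes f :: "'b \<Rightarrow> 'a :: semiring_1"
  shows "sum_list (map f (concat (map (\<lambda>k. replicate (m k) (x k)) ks))) = (\<Sum>k\<leftarrow>ks. of_nat (m k) * f (x k))"
  by (induction ks) (simp_all add: sum_list_replicate)

lemma mat_trace_kronecker: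
  fixes A B :: "'a :: comm_semiring_0 mat"
  assumes "A \<in> carrier_mat m m" "B \<in> carrier_mat n n"
  shows "mat_trace (kronecker A B) = mat_trace A * mat_trace B"
proof (cases "n = 0")
  case True
  then show ?thesis using assms by (simp add: mat_trace_def kronecker_def)
next
  case n: False
  have "mat_trace (kronecker A B) = (\<Sum>i<m * n. A $$ (i div n, i div n) * B $$ (i mod n, i mod n))"
    using assms by (simp add: mat_trace_def kronecker_def)
  also have "\<dots> = (\<Sum>k<m. \<Sum>i = k * n..<k * n + n. A $$ (i div n, i div n) * B $$ (i mod n, i mod n))"
    by (rule sum.nat_group[symmetric])
  also have "\<dots> = (\<Sum>k<m. \<Sum>i<n. A $$ (k, k) * B $$ (i, i))"
  proof (rule sum.cong)
    fix k assume "k \<in> {..<m}"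
    have "(\<Sum>i = k * n..<k * n + n. A $$ (i div n, i div n) * B $$ (i mod n, i mod n)) =
        (\<Sum>i = 0..<n. A $$ ((i + k * n) div n, (i + k * n) div n) * B $$ ((i + k * n) mod n, (i + k * n) mod n))"
      using sum.shift_bounds_nat_ivl[of "\<lambda>i. A $$ (i div n, i div n) * B $$ (i mod n, i mod n)" 0 "k * n" n]
      by (simp add: add.commute)
    also have "\<dots> = (\<Sum>i<n. A $$ (k, k) * B $$ (i, i))"
      unfolding lessThan_atLeast0 using n by (intro sum.cong) auto
    finally show "(\<Sum>i = k * n..<k * n + n. A $$ (i div n, i div n) * B $$ (i mod n, i mod n)) =
      (\<Sum>i<n. A $$ (k, k) * B $$ (i, i))" .
  qed simp
  also have "\<dots> = mat_trace A * mat_trace B"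
    using assms by (simp add: mat_trace_def sum_product)
  finally show ?thesis .
qed

lemma vec_subspaceI:
  fixes W :: "complex vec set"
  assumes "W \<subseteq> carrier_vec n" "0\<^sub>v n \<in> W"
    and "\<And>v w. v \<in> W \<Longrightarrow> w \<in> W \<Longrightarrow> v + w \<in> W" "\<And>c v. v \<in> W \<Longrightarrow> c \<cdot>\<^sub>v v \<in> W"
  shows "VectorSpace.subspace class_ring W (module_vec TYPE(complex) n)"
proof -
  interpret vec_space "TYPE(complex)" n .
  show ?thesis
    using assms by unfold_locales (auto simp: module_vec_simps)
qed

lemma mat_eq_if_mult_vec_eq:
  fixes A B :: "'a :: comm_ring_1 mat"
  assumes A: "A \<in> carrier_mat m n" and B: "B \<in> carrier_mat m n"
    and eq: "\<And>v. v \<in> carrier_vec n \<Longrightarrow> A *\<^sub>v v = B *\<^sub>v v"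
  shows "A = B"
proof (rule mat_col_eqI)
  fix j assume "j < dim_col B"
  then have j: "j < n" using B by simp
  have "M *\<^sub>v unit_vec n j = col M j" if "M \<in> carrier_mat m n" for M :: "'a mat"
    using that j by (intro eq_vecI) (auto simp: scalar_prod_right_unit)
  then show "col A j = col B j"
    using eq[of "unit_vec n j"] A B by simp
qed (use A B in auto)

lemma mult_mat_zero_vec: "A \<in> carrier_mat m n \<Longrightarrow> A *\<^sub>v 0\<^sub>v n = (0\<^sub>v m :: 'a :: semiring_0 vec)"
  by (intro eq_vecI) auto

text \<open>The conditions make \<open>G\<close> a subgroup, because multiplication by an element of \<open>SU(2)\<close> is
injective and hence permutes the finite set \<open>G\<close>; this is the form in which the group property
is used (\<open>sum_translate\<close>).\<close>

locale finite_SU2_group =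
  fixes G :: "complex mat set"
  assumes finite_G [simp]: "finite G"
    and in_SU2: "G \<subseteq> carrier SU2"
    and one_in_G [simp]: "1\<^sub>m 2 \<in> G"
    and mult_in_G [simp]: "\<And>g h. g \<in> G \<Longrightarrow> h \<in> G \<Longrightarrow> g * h \<in> G"
begin

lemma G_carrier: "g \<in> G \<Longrightarrow> g \<in> carrier_mat 2 2"
  using in_SU2 by (auto simp: SU2_def)

lemma G_nonempty [simp]: "G \<noteq> {}"
  using one_in_G by blast

lemma sum_translate:
  assumes "h \<in> G"
  shows "(\<Sum>g\<in>G. f (h * g)) = (\<Sum>g\<in>G. f g)"
proof -
  have h: "h \<in> carrier_mat 2 2" "h * mat_adjoint h = 1\<^sub>m 2" using assms in_SU2 by (auto simp: SU2_def)
  have a: "mat_adjoint h \<in> carrier_mat 2 2" using h(1) by (auto simp: mat_adjoint_def mat_of_rows_def)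
  have inv: "mat_adjoint h * h = 1\<^sub>m 2" by (rule mat_mult_left_right_inverse[OF h(1) a h(2)])
  have inj: "inj_on ((*) h) G"
  proof (rule inj_onI)
    fix g g' assume g: "g \<in> G" "g' \<in> G" and eq: "h * g = h * g'"
    then have "(mat_adjoint h * h) * g = (mat_adjoint h * h) * g'"
      using h(1) a G_carrier by (metis assoc_mult_mat)
    then show "g = g'" using inv g by (metis G_carrier left_mult_one_mat)
  qed
  have "(*) h ` G = G"
    by (rule endo_inj_surj) (use assms inj in auto)
  then show ?thesis using sum.reindex[OF inj, of f] by simp
qed

context
  fixes n \<rho>
  assumes rep: "representation G n \<rho>"
begin

lemma rep_carrier: "g \<in> G \<Longrightarrow> \<rho> g \<in> carrier_mat n n"
  using rep by (auto simp: representation_def hom_def GL_def)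

lemma rep_mult: "g \<in> G \<Longrightarrow> h \<in> G \<Longrightarrow> \<rho> (g * h) = \<rho> g * \<rho> h"
  using rep by (auto simp: representation_def hom_def GL_def SU2_def)

text \<open>A representation is only required to be multiplicative, but its value at the identity is an
invertible idempotent.\<close>

lemma rep_one: "\<rho> (1\<^sub>m 2) = 1\<^sub>m n"
proof -
  let ?E = "\<rho> (1\<^sub>m 2)"
  have E: "?E \<in> carrier_mat n n" by (simp add: rep_carrier)
  have EE: "?E * ?E = ?E" using rep_mult[of "1\<^sub>m 2" "1\<^sub>m 2"] by simp
  have "invertible_mat ?E" using rep one_in_G by (auto simp: representation_def hom_def GL_def simp del: one_in_G)
  then obtain S where TS: "?E * S = 1\<^sub>m n" and ST: "S * ?E = 1\<^sub>m (dim_row S)"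
    using E by (auto simp: invertible_mat_def inverts_mat_def)
  have "dim_col S = n" using arg_cong[OF TS, of dim_col] by simp
  moreover have "dim_row S = n" using arg_cong[OF ST, of dim_col] E by simp
  ultimately have S: "S \<in> carrier_mat n n" by auto
  have "?E = ?E * (?E * S)" using TS E by simp
  also have "\<dots> = (?E * ?E) * S" using assoc_mult_mat[OF E E S] by simp
  finally show ?thesis using EE TS by simp
qed

lemma rep_mult_vec: "g \<in> G \<Longrightarrow> h \<in> G \<Longrightarrow> v \<in> carrier_vec n \<Longrightarrow> \<rho> g *\<^sub>v (\<rho> h *\<^sub>v v) = \<rho> (g * h) *\<^sub>v v"
  using assoc_mult_mat_vec[of "\<rho> g" n n "\<rho> h" n v] rep_carrier by (simp add: rep_mult)

end

text \<open>The fixed vectors form an invariant subspace, which is not everything, hence zero. The columns of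
\<open>\<Sum>g\<in>G. \<rho> g\<close> are fixed vectors, so this matrix is zero and has trace zero.\<close>

lemma sum_mat_trace_irreducible:
  assumes irr: "irreducible_rep G n \<rho>" and nontriv: "\<not> (\<forall>g\<in>G. \<rho> g = 1\<^sub>m n)"
  shows "(\<Sum>g\<in>G. mat_trace (\<rho> g)) = 0"
proof -
  have rep: "representation G n \<rho>" using irr by (simp add: irreducible_rep_def)
  note car = rep_carrier[OF rep]
  define W where "W = {v \<in> carrier_vec n. \<forall>g\<in>G. \<rho> g *\<^sub>v v = v}"
  have "VectorSpace.subspace class_ring W (module_vec TYPE(complex) n)"
    by (rule vec_subspaceI)
      (use car in \<open>auto simp: W_def mult_add_distrib_mat_vec[OF car] mult_mat_vec[OF car] mult_mat_zero_vec[OF car]\<close>)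
  moreover have "\<forall>g\<in>G. \<forall>w\<in>W. \<rho> g *\<^sub>v w \<in> W" by (auto simp: W_def)
  ultimately have "W = {0\<^sub>v n} \<or> W = carrier_vec n"
    using irr by (simp add: irreducible_rep_def)
  moreover have "W \<noteq> carrier_vec n"
  proof
    assume W: "W = carrier_vec n"
    have "\<rho> g = 1\<^sub>m n" if "g \<in> G" for g
      by (rule mat_eq_if_mult_vec_eq[OF car[OF that]]) (use W that in \<open>auto simp: W_def\<close>)
    with nontriv show False by blast
  qed
  ultimately have W: "W = {0\<^sub>v n}" by blast
  define S where "S = mat n n (\<lambda>(i, j). \<Sum>g\<in>G. \<rho> g $$ (i, j))"
  have S: "S \<in> carrier_mat n n" by (simp add: S_def)
  have hS: "\<rho> h * S = S" if h: "h \<in> G" for h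
  proof (rule eq_matI)
    fix i j assume "i < dim_row S" "j < dim_col S"
    then have i: "i < n" and j: "j < n" using S by auto
    have "(\<rho> h * S) $$ (i, j) = (\<Sum>l = 0..<n. \<rho> h $$ (i, l) * (\<Sum>g\<in>G. \<rho> g $$ (l, j)))"
      using i j car[OF h] by (simp add: S_def scalar_prod_def)
    also have "\<dots> = (\<Sum>g\<in>G. \<Sum>l = 0..<n. \<rho> h $$ (i, l) * \<rho> g $$ (l, j))"
      by (simp add: sum_distrib_left sum.swap[of _ _ G])
    also have "\<dots> = (\<Sum>g\<in>G. \<rho> (h * g) $$ (i, j))"
    proof (rule sum.cong)
      fix g assume "g \<in> G"
      then show "(\<Sum>l = 0..<n. \<rho> h $$ (i, l) * \<rho> g $$ (l, j)) = \<rho> (h * g) $$ (i, j)"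
        using i j car[OF h] car[of g] by (simp add: rep_mult[OF rep h] scalar_prod_def)
    qed simp
    also have "\<dots> = S $$ (i, j)" using sum_translate[OF h, of "\<lambda>g. \<rho> g $$ (i, j)"] i j by (simp add: S_def)
    finally show "(\<rho> h * S) $$ (i, j) = S $$ (i, j)" .
  qed (use S car h in auto)
  have "S $$ (i, i) = 0" if i: "i < n" for i
  proof -
    have "col S i \<in> W"
      unfolding W_def using i S car by (auto simp: hS simp flip: col_mult2[of _ n n S n i])
    then show ?thesis using W i S by (metis carrier_matD index_col index_zero_vec(1) singletonD)
  qed
  then have "(\<Sum>i<n. S $$ (i, i)) = 0" by simp
  moreover have "(\<Sum>i<n. S $$ (i, i)) = (\<Sum>g\<in>G. mat_trace (\<rho> g))"
  proof -
    have "(\<Sum>g\<in>G. mat_trace (\<rho> g)) = (\<Sum>g\<in>G. \<Sum>i<n. \<rho> g $$ (i, i))"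
      by (rule sum.cong) (use car in \<open>auto simp: mat_trace_def\<close>)
    also have "\<dots> = (\<Sum>i<n. S $$ (i, i))"
      by (subst sum.swap) (simp add: S_def)
    finally show ?thesis ..
  qed
  ultimately show ?thesis by simp
qed

text \<open>Every subspace is invariant under a trivial action, in particular the hyperplane of vectors with
vanishing entry 0.\<close>

lemma trivial_irreducible_degree:
  assumes irr: "irreducible_rep G n \<rho>" and triv: "\<And>g. g \<in> G \<Longrightarrow> \<rho> g = 1\<^sub>m n"
  shows "n = 1"
proof (rule ccontr)
  assume "n \<noteq> 1"
  moreover have "n > 0" using irr by (simp add: irreducible_rep_def)
  ultimately have n: "n > 1" by simp
  define W where "W = {v \<in> carrier_vec n. v $ 0 = (0 :: complex)}"
  have "VectorSpace.subspace class_ring W (module_vec TYPE(complex) n)"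
    by (rule vec_subspaceI) (use n in \<open>auto simp: W_def\<close>)
  moreover have "\<forall>g\<in>G. \<forall>w\<in>W. \<rho> g *\<^sub>v w \<in> W" by (auto simp: W_def triv)
  ultimately have "W = {0\<^sub>v n} \<or> W = carrier_vec n"
    using irr by (simp add: irreducible_rep_def)
  moreover have "unit_vec n 1 \<in> W" "unit_vec n 1 \<noteq> (0\<^sub>v n :: complex vec)"
    using n by (auto simp: W_def dest!: arg_cong[where f = "\<lambda>v. v $ 1"])
  moreover have "unit_vec n 0 \<notin> W" "unit_vec n 0 \<in> carrier_vec n" using n by (auto simp: W_def)
  ultimately show False by blast
qed

lemma sum_mat_trace_irreps:
  assumes irr: "irreps_of G r d \<rho>" and k: "k \<le> r"
  shows "(\<Sum>g\<in>G. mat_trace (\<rho> k g)) = (if k = 0 then of_nat (card G) else 0)"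
proof (cases "k = 0")
  case True
  then show ?thesis using irr by (simp add: irreps_of_def)
next
  case k0: False
  have irrk: "irreducible_rep G (d k) (\<rho> k)" and irr0: "irreducible_rep G (d 0) (\<rho> 0)"
    and d0: "d 0 = 1" and triv0: "\<And>g. g \<in> G \<Longrightarrow> \<rho> 0 g = 1\<^sub>m 1"
    using irr k by (auto simp: irreps_of_def)
  have "\<not> (\<forall>g\<in>G. \<rho> k g = 1\<^sub>m (d k))"
  proof
    assume triv: "\<forall>g\<in>G. \<rho> k g = 1\<^sub>m (d k)"
    then have dk: "d k = 1" using trivial_irreducible_degree[OF irrk] by simp
    have one: "1\<^sub>m 1 \<in> carrier (GL 1)"
      by (auto simp: GL_def invertible_mat_def inverts_mat_def intro!: exI[of _ "1\<^sub>m 1"])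
    have rep: "representation G 1 (\<rho> k)" "representation G 1 (\<rho> 0)"
      using irrk irr0 dk d0 by (auto simp: irreducible_rep_def)
    have "equivalent_rep G 1 (\<rho> k) (\<rho> k)" "equivalent_rep G 1 (\<rho> k) (\<rho> 0)"
      using rep one triv triv0 dk by (auto simp: equivalent_rep_def)
    then have "0 \<le> r \<and> d k = d 0 \<and> equivalent_rep G (d k) (\<rho> k) (\<rho> 0)"
      "k \<le> r \<and> d k = d k \<and> equivalent_rep G (d k) (\<rho> k) (\<rho> k)"
      using dk d0 k by auto
    moreover have "\<exists>!j. j \<le> r \<and> d k = d j \<and> equivalent_rep G (d k) (\<rho> k) (\<rho> j)"
      using irr irrk by (simp add: irreps_of_def)
    ultimately show False using k0 by blast
  qed
  from sum_mat_trace_irreducible[OF irrk this] show ?thesis using k0 by simp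
qed

text \<open>As \<open>- 1\<close> is a central involution, its fixed vectors in the representation form an invariant
subspace. If this is zero, then \<open>v + \<rho> (- 1) v\<close> vanishes for every \<open>v\<close>, because it is fixed.\<close>

lemma irreducible_minus_one:
  assumes irr: "irreducible_rep G n \<rho>" and minus: "- 1\<^sub>m 2 \<in> G"
  shows "\<rho> (- 1\<^sub>m 2) = 1\<^sub>m n \<or> \<rho> (- 1\<^sub>m 2) = - 1\<^sub>m n"
proof -
  let ?m = "- 1\<^sub>m 2 :: complex mat"
  have rep: "representation G n \<rho>" using irr by (simp add: irreducible_rep_def)
  note car = rep_carrier[OF rep]
  note mcar = car[OF minus]
  have mm: "?m * ?m = 1\<^sub>m 2" by (rule eq_matI) auto
  have comm: "?m * g = g * ?m" if "g \<in> G" for g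
    using G_carrier[OF that] by simp
  define W where "W = {v \<in> carrier_vec n. \<rho> ?m *\<^sub>v v = v}"
  have "VectorSpace.subspace class_ring W (module_vec TYPE(complex) n)"
    by (rule vec_subspaceI)
      (use mcar in \<open>auto simp: W_def mult_add_distrib_mat_vec[OF mcar] mult_mat_vec[OF mcar] mult_mat_zero_vec[OF mcar]\<close>)
  moreover have "\<rho> g *\<^sub>v w \<in> W" if g: "g \<in> G" and w: "w \<in> W" for g w
  proof -
    have wc: "w \<in> carrier_vec n" using w by (simp add: W_def)
    have "\<rho> ?m *\<^sub>v (\<rho> g *\<^sub>v w) = \<rho> g *\<^sub>v (\<rho> ?m *\<^sub>v w)"
      unfolding rep_mult_vec[OF rep minus g wc] rep_mult_vec[OF rep g minus wc] comm[OF g] ..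
    then show ?thesis using w car[OF g] by (auto simp: W_def)
  qed
  ultimately consider "W = {0\<^sub>v n}" | "W = carrier_vec n"
    using irr by (auto simp: irreducible_rep_def)
  then show ?thesis
  proof cases
    case 1
    have "\<rho> ?m *\<^sub>v v = (- 1\<^sub>m n) *\<^sub>v v" if v: "v \<in> carrier_vec n" for v
    proof -
      have mv: "\<rho> ?m *\<^sub>v v \<in> carrier_vec n" using v mcar by simp
      have "\<rho> ?m *\<^sub>v (\<rho> ?m *\<^sub>v v) = v"
        using v minus mm rep_one[OF rep] by (simp add: rep_mult_vec[OF rep])
      then have "v + \<rho> ?m *\<^sub>v v \<in> W"
        using v mv mcar by (simp add: W_def mult_add_distrib_mat_vec[OF mcar] comm_add_vec[OF mv v])
      then have z: "v + \<rho> ?m *\<^sub>v v = 0\<^sub>v n" using 1 by simp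
      have neg: "(- 1\<^sub>m n) *\<^sub>v v = - v" using v by simp
      show ?thesis
      proof (rule eq_vecI)
        fix i assume "i < dim_vec ((- 1\<^sub>m n) *\<^sub>v v)"
        then have i: "i < n" by simp
        then have "v $ i + (\<rho> ?m *\<^sub>v v) $ i = 0"
          using arg_cong[OF z, of "\<lambda>w. w $ i"] v mv by (metis carrier_vecD index_add_vec(1) index_zero_vec(1))
        then show "(\<rho> ?m *\<^sub>v v) $ i = ((- 1\<^sub>m n) *\<^sub>v v) $ i"
          using neg v i by (simp add: add_eq_0_iff del: index_mult_mat_vec)
      qed (use mcar in simp)
    qed
    then have "\<rho> ?m = - 1\<^sub>m n" by (intro mat_eq_if_mult_vec_eq[OF mcar]) auto
    then show ?thesis ..
  next
    case 2
    have "\<rho> ?m = 1\<^sub>m n"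
      by (rule mat_eq_if_mult_vec_eq[OF mcar]) (use 2 in \<open>auto simp: W_def\<close>)
    then show ?thesis ..
  qed
qed

lemma mckay_character:
  assumes irr: "irreps_of G r d \<rho>" and mckay: "mckay_multiplicities G r d \<rho> a"
    and j: "j \<le> r" and g: "g \<in> G"
  shows "mat_trace g * mat_trace (\<rho> j g) = (\<Sum>k\<le>r. of_nat (a j k) * mat_trace (\<rho> k g))"
proof -
  have car: "\<rho> k g \<in> carrier_mat (d k) (d k)" if "k \<le> r" for k
    using irr that g rep_carrier by (auto simp: irreps_of_def irreducible_rep_def)
  have sq: "square_mat (\<rho> k g)" if "k \<le> r" for k using car[OF that] by simp
  have eqv: "equivalent_rep G (2 * d j) (\<lambda>g. kronecker g (\<rho> j g)) (direct_sum_rep r (a j) \<rho>)"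
    using mckay j by (simp add: mckay_multiplicities_def)
  then obtain T where T: "T \<in> carrier (GL (2 * d j))"
    "T * kronecker g (\<rho> j g) = direct_sum_rep r (a j) \<rho> g * T"
    using g by (auto simp: equivalent_rep_def)
  have "kronecker g (\<rho> j g) \<in> carrier_mat (2 * d j) (2 * d j)"
    "direct_sum_rep r (a j) \<rho> g \<in> carrier_mat (2 * d j) (2 * d j)"
    using eqv rep_carrier g by (auto simp: equivalent_rep_def)
  from mat_trace_intertwined[OF this T]
  have "mat_trace g * mat_trace (\<rho> j g) = mat_trace (direct_sum_rep r (a j) \<rho> g)"
    using mat_trace_kronecker[OF G_carrier[OF g] car[OF j]] by simp
  also have "\<dots> = sum_list (map mat_trace (concat (map (\<lambda>k. replicate (a j k) (\<rho> k g)) [0..<Suc r])))"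
    unfolding direct_sum_rep_def by (rule mat_trace_diag_block_mat) (use sq in \<open>auto simp: less_Suc_eq_le simp del: upt_Suc\<close>)
  also have "\<dots> = (\<Sum>k\<leftarrow>[0..<Suc r]. of_nat (a j k) * mat_trace (\<rho> k g))"
    by (rule sum_list_map_concat_replicate)
  also have "\<dots> = (\<Sum>k\<le>r. of_nat (a j k) * mat_trace (\<rho> k g))"
    by (simp add: interv_sum_list_conv_sum_set_nat atLeastLessThanSuc_atLeastAtMost atMost_atLeast0 del: upt_Suc)
  finally show ?thesis .
qed

text \<open>Let \<open>s\<^sub>k\<close> be the sign by which \<open>- 1\<close> acts on \<open>\<rho>\<^sub>k\<close>. The characters of \<open>\<complex>\<^sup>2 \<otimes> \<rho>\<^sub>j\<close> at \<open>1\<close> and \<open>- 1\<close>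
give \<open>(\<Sum>k. a\<^sub>j\<^sub>k d\<^sub>k) = 2 d\<^sub>j\<close> and \<open>(\<Sum>k. a\<^sub>j\<^sub>k s\<^sub>k d\<^sub>k) = - 2 s\<^sub>j d\<^sub>j\<close>, so
\<open>(\<Sum>k. a\<^sub>j\<^sub>k d\<^sub>k (1 + s\<^sub>j s\<^sub>k)) = 0\<close>. All summands are nonnegative, and the one for \<open>k = j\<close> is
\<open>2 a\<^sub>j\<^sub>j d\<^sub>j\<close>.\<close>

lemma mckay_no_loop:
  assumes minus: "- 1\<^sub>m 2 \<in> G" and irr: "irreps_of G r d \<rho>"
    and mckay: "mckay_multiplicities G r d \<rho> a" and j: "j \<le> r"
  shows "a j j = 0"
proof -
  let ?m = "- 1\<^sub>m 2 :: complex mat"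
  define s where "s k = (if \<rho> k ?m = 1\<^sub>m (d k) then 1 else - 1 :: int)" for k
  have irrk: "irreducible_rep G (d k) (\<rho> k)" if "k \<le> r" for k
    using irr that by (auto simp: irreps_of_def)
  then have rep: "representation G (d k) (\<rho> k)" "d k > 0" if "k \<le> r" for k
    using that by (auto simp: irreducible_rep_def)
  have one: "mat_trace (\<rho> k (1\<^sub>m 2)) = of_nat (d k)" if "k \<le> r" for k
    using rep_one[OF rep(1)[OF that]] by simp
  have trm: "mat_trace (- 1\<^sub>m n :: complex mat) = - of_nat n" for n
    by (simp add: mat_trace_def)
  have mone: "mat_trace (\<rho> k ?m) = of_int (s k) * of_nat (d k)" if "k \<le> r" for k
    using irreducible_minus_one[OF irrk[OF that] minus] by (auto simp: s_def trm)
  have 1: "2 * of_nat (d j) = (\<Sum>k\<le>r. of_nat (a j k) * of_nat (d k) :: complex)"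
    using mckay_character[OF irr mckay j one_in_G] j by (simp add: one)
  have 2: "- 2 * (of_int (s j) * of_nat (d j)) = (\<Sum>k\<le>r. of_nat (a j k) * (of_int (s k) * of_nat (d k)) :: complex)"
    using mckay_character[OF irr mckay j minus] j by (simp add: mone trm)
  have ss: "s j * s j = 1" by (simp add: s_def)
  have "of_int (\<Sum>k\<le>r. int (a j k * d k) * (1 + s j * s k)) =
      (\<Sum>k\<le>r. of_nat (a j k) * of_nat (d k) + of_int (s j) * (of_nat (a j k) * (of_int (s k) * of_nat (d k))) :: complex)"
    unfolding of_int_sum by (rule sum.cong) (simp_all add: algebra_simps)
  also have "\<dots> = (\<Sum>k\<le>r. of_nat (a j k) * of_nat (d k)) +
      of_int (s j) * (\<Sum>k\<le>r. of_nat (a j k) * (of_int (s k) * of_nat (d k)))"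
    by (simp only: sum.distrib sum_distrib_left)
  also have "\<dots> = 2 * of_nat (d j) * (1 - of_int (s j * s j))"
    unfolding 1[symmetric] 2[symmetric] by (simp add: algebra_simps)
  also have "\<dots> = of_int 0" using ss by simp
  finally have "(\<Sum>k\<le>r. int (a j k * d k) * (1 + s j * s k)) = 0"
    unfolding of_int_eq_iff .
  moreover have "int (a j k * d k) * (1 + s j * s k) \<ge> 0" for k
    by (auto simp: s_def)
  ultimately have "int (a j j * d j) * (1 + s j * s j) = 0"
    using j by (subst (asm) sum_nonneg_eq_0_iff) auto
  then show ?thesis using ss rep(2)[OF j] by simp
qed

end

section \<open>Characters of the symmetric powers and invariants\<close>

text \<open>The trace of a projection \<open>P\<close> onto \<open>V\<close>, computed in coordinates \<open>c\<close> with respect to vectors \<open>e\<close>,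
is the dimension of \<open>V\<close>. For a basis \<open>B\<close> of \<open>V\<close> let \<open>\<phi> b w\<close> be the \<open>b\<close>-coordinate of \<open>w \<in> V\<close>. Expanding
\<open>P (e i)\<close> in \<open>B\<close> turns the trace into a sum over \<open>b \<in> B\<close> of
\<open>(\<Sum>i\<in>I. c i b * \<phi> b (P (e i))) = \<phi> b (P b) = \<phi> b b = 1\<close>.
The vectors \<open>e\<close> may lie outside \<open>V\<close>.\<close>

lemma (in vector_space) dim_eq_trace_projection:
  assumes V: "subspace V" and I: "finite I"
    and expand: "\<And>v. v \<in> V \<Longrightarrow> v = (\<Sum>i\<in>I. scale (c i v) (e i))"
    and c_add: "\<And>i v w. c i (v + w) = c i v + c i w"
    and c_scale: "\<And>i x v. c i (scale x v) = x * c i v"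
    and P_add: "\<And>v w. P (v + w) = P v + P w"
    and P_scale: "\<And>x v. P (scale x v) = scale x (P v)"
    and P_in: "\<And>i. i \<in> I \<Longrightarrow> P (e i) \<in> V" and P_id: "\<And>v. v \<in> V \<Longrightarrow> P v = v"
  shows "of_nat (dim V) = (\<Sum>i\<in>I. c i (P (e i)))"
proof -
  obtain B where B: "B \<subseteq> V" "independent B" "V \<subseteq> span B" "card B = dim V"
    by (rule basis_exists)
  have "V \<subseteq> span (e ` I)"
  proof
    fix v assume "v \<in> V"
    have "(\<Sum>i\<in>I. scale (c i v) (e i)) \<in> span (e ` I)"
      by (intro span_sum span_scale span_base imageI)
    then show "v \<in> span (e ` I)" using expand[OF \<open>v \<in> V\<close>] by simp
  qed
  then have fin: "finite B"
    using independent_span_bound[OF _ B(2)] B(1) I by blast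
  define \<phi> where "\<phi> b v = representation B v b" for b v
  have Pe: "P (e i) \<in> span B" if "i \<in> I" for i using P_in[OF that] B(3) by blast
  have c_zero: "c i 0 = 0" for i using c_scale[of i 0 0] by simp
  have c_sum: "c i (\<Sum>b\<in>A. f b) = (\<Sum>b\<in>A. c i (f b))" for i A and f :: "'b \<Rightarrow> 'b"
    by (induction A rule: infinite_finite_induct) (simp_all add: c_zero c_add)
  have P_zero: "P 0 = 0" using P_scale[of 0 0] by simp
  have P_sum: "P (\<Sum>i\<in>A. f i) = (\<Sum>i\<in>A. P (f i))" for A and f :: "_ \<Rightarrow> 'b"
    by (induction A rule: infinite_finite_induct) (simp_all add: P_zero P_add)
  have one: "(\<Sum>i\<in>I. c i b * \<phi> b (P (e i))) = 1" if b: "b \<in> B" for b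
  proof -
    have bV: "b \<in> V" using b B by blast
    have "b = P (\<Sum>i\<in>I. scale (c i b) (e i))" using P_id[OF bV] expand[OF bV] by simp
    also have "\<dots> = (\<Sum>i\<in>I. scale (c i b) (P (e i)))" by (simp add: P_sum P_scale)
    finally have "\<phi> b b = \<phi> b (\<Sum>i\<in>I. scale (c i b) (P (e i)))" by simp
    also have "\<dots> = (\<Sum>i\<in>I. representation B (scale (c i b) (P (e i))) b)"
      unfolding \<phi>_def using Pe by (subst representation_sum[OF B(2)]) (auto intro: span_scale)
    also have "\<dots> = (\<Sum>i\<in>I. c i b * \<phi> b (P (e i)))"
      unfolding \<phi>_def using Pe by (intro sum.cong) (auto simp: representation_scale[OF B(2)])
    finally show ?thesis using representation_basis[OF B(2) b] by (simp add: \<phi>_def)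
  qed
  have "(\<Sum>i\<in>I. c i (P (e i))) = (\<Sum>i\<in>I. \<Sum>b\<in>B. c i b * \<phi> b (P (e i)))"
  proof (rule sum.cong)
    fix i assume i: "i \<in> I"
    have "P (e i) = (\<Sum>b\<in>B. scale (\<phi> b (P (e i))) b)"
      unfolding \<phi>_def by (rule sum_representation_eq[OF B(2) Pe[OF i] fin order_refl, symmetric])
    then have "c i (P (e i)) = c i (\<Sum>b\<in>B. scale (\<phi> b (P (e i))) b)" by simp
    then show "c i (P (e i)) = (\<Sum>b\<in>B. c i b * \<phi> b (P (e i)))"
      by (simp add: c_sum c_scale mult.commute)
  qed simp
  also have "\<dots> = (\<Sum>b\<in>B. \<Sum>i\<in>I. c i b * \<phi> b (P (e i)))" by (rule sum.swap)
  also have "\<dots> = of_nat (dim V)" using one B(4) by simp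
  finally show ?thesis ..
qed

lemma comm_ring_hom_poly_map_poly:
  assumes "comm_ring_hom h"
  shows "comm_ring_hom (\<lambda>p. poly (map_poly h p) x)"
proof -
  interpret h: comm_ring_hom h by fact
  interpret map_h: map_poly_comm_ring_hom h ..
  show ?thesis by unfold_locales (simp_all add: hom_distribs)
qed

definition image_x :: "complex mat \<Rightarrow> complex poly poly" where
  "image_x U = bivariate_scale (U $$ (0, 0)) sym_x + bivariate_scale (U $$ (1, 0)) sym_y"

definition image_y :: "complex mat \<Rightarrow> complex poly poly" where
  "image_y U = bivariate_scale (U $$ (0, 1)) sym_x + bivariate_scale (U $$ (1, 1)) sym_y"

lemma bivariate_scale_eq_mult: "bivariate_scale c f = [:[:c:]:] * f"
  by simp

lemma bivariate_scale_add_left: "bivariate_scale (a + b) f = bivariate_scale a f + bivariate_scale b f"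
  by (simp flip: smult_add_left)

text \<open>Iterated evaluation of polynomials is a ring homomorphism, which makes the algebra structure of
the action available.\<close>

lemma sym_action_eq_poly:
  "sym_action U f = poly (map_poly (\<lambda>p. poly (map_poly (\<lambda>c. [:[:c:]:]) p) (image_x U)) f) (image_y U)"
proof -
  have "poly (map_poly (\<lambda>p. poly (map_poly (\<lambda>c. [:[:c:]:]) p) (image_x U)) f) (image_y U) =
    (\<Sum>j\<le>degree f. image_y U ^ j * (\<Sum>i\<le>degree (coeff f j). image_x U ^ i * [:[:bivariate_coeff f i j:]:]))"
    by (simp add: eval_poly_as_sum flip: eval_poly_def)
  also have "\<dots> = sym_action U f"
    unfolding sym_action_def Let_def image_x_def[symmetric] image_y_def[symmetric]
    by (simp add: sum_distrib_left ac_simps)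
  finally show ?thesis ..
qed

lemma comm_ring_hom_sym_action: "comm_ring_hom (sym_action U)"
proof -
  have "comm_ring_hom (\<lambda>c :: complex. [:[:c:]:])" by unfold_locales auto
  then show ?thesis
    unfolding sym_action_eq_poly[abs_def] by (intro comm_ring_hom_poly_map_poly)
qed

interpretation sym_action: comm_ring_hom "sym_action U" for U
  by (rule comm_ring_hom_sym_action)

lemma sym_action_scale: "sym_action U (bivariate_scale c f) = bivariate_scale c (sym_action U f)"
proof -
  have "sym_action U [:[:c:]:] = [:[:c:]:]" by (simp add: sym_action_def flip: one_pCons)
  then show ?thesis by (simp only: bivariate_scale_eq_mult sym_action.hom_mult)
qed

lemma sym_action_x: "sym_action U sym_x = image_x U"
  unfolding sym_action_def Let_def image_x_def[symmetric] image_y_def[symmetric]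
  by (simp add: sym_x_def flip: one_pCons)

lemma sym_action_y: "sym_action U sym_y = image_y U"
  unfolding sym_action_def Let_def image_x_def[symmetric] image_y_def[symmetric]
  by (simp add: sym_y_def flip: one_pCons)

abbreviation monomial_xy :: "nat \<Rightarrow> nat \<Rightarrow> complex poly poly" where
  "monomial_xy i j \<equiv> sym_x ^ i * sym_y ^ j"

lemma sym_x_power: "sym_x ^ i = [:monom 1 i:]"
proof -
  have "sym_x ^ i = [:[:0, 1:] ^ i:]" unfolding sym_x_def by (rule poly_const_pow)
  then show ?thesis by (simp add: monom_altdef)
qed

lemma sym_y_power: "sym_y ^ j = monom 1 j"
  by (simp add: sym_y_def monom_altdef)

lemma bivariate_coeff_monomial: "bivariate_coeff (monomial_xy i j) k l = (if k = i \<and> l = j then 1 else 0)"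
  by (simp add: sym_x_power sym_y_power smult_monom)

lemma sym_power_expand:
  assumes "f \<in> sym_power n"
  shows "f = (\<Sum>i\<le>n. bivariate_scale (bivariate_coeff f i (n - i)) (monomial_xy i (n - i)))"
proof (intro poly_eqI)
  fix k l
  have "bivariate_coeff (\<Sum>i\<le>n. bivariate_scale (bivariate_coeff f i (n - i)) (monomial_xy i (n - i))) l k =
      (\<Sum>i\<le>n. if i = l then (if l + k = n then bivariate_coeff f l k else 0) else 0)"
    unfolding coeff_sum by (rule sum.cong) (auto simp: bivariate_coeff_monomial)
  also have "\<dots> = bivariate_coeff f l k"
    using assms by (auto simp: sym_power_def)
  finally show "bivariate_coeff f l k =
    bivariate_coeff (\<Sum>i\<le>n. bivariate_scale (bivariate_coeff f i (n - i)) (monomial_xy i (n - i))) l k" ..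
qed

lemma sym_power_zero [simp]: "0 \<in> sym_power n"
  by (simp add: sym_power_def)

lemma sym_power_add: "f \<in> sym_power n \<Longrightarrow> g \<in> sym_power n \<Longrightarrow> f + g \<in> sym_power n"
  unfolding sym_power_def by (auto, metis add.right_neutral)

lemma sym_power_scale: "f \<in> sym_power n \<Longrightarrow> bivariate_scale c f \<in> sym_power n"
  by (auto simp: sym_power_def)

lemma sym_power_sum: "(\<And>i. i \<in> A \<Longrightarrow> f i \<in> sym_power n) \<Longrightarrow> (\<Sum>i\<in>A. f i) \<in> sym_power n"
  by (induction A rule: infinite_finite_induct) (auto intro: sym_power_add)

lemma sym_power_mult:
  assumes "f \<in> sym_power m" "g \<in> sym_power n"
  shows "f * g \<in> sym_power (m + n)"
proof -
  have "bivariate_coeff (f * g) k l = 0" if "k + l \<noteq> m + n" for k l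
  proof -
    have "bivariate_coeff (f * g) k l =
        (\<Sum>j\<le>l. \<Sum>i\<le>k. bivariate_coeff f i j * bivariate_coeff g (k - i) (l - j))"
      by (simp add: coeff_mult coeff_sum)
    also have "\<dots> = 0"
    proof (intro sum.neutral ballI)
      fix i j assume "j \<in> {..l}" "i \<in> {..k}"
      then have "i + j \<noteq> m \<or> (k - i) + (l - j) \<noteq> n" using that by auto
      then show "bivariate_coeff f i j * bivariate_coeff g (k - i) (l - j) = 0"
        using assms by (auto simp: sym_power_def)
    qed
    finally show ?thesis .
  qed
  then show ?thesis by (auto simp: sym_power_def)
qed

lemma sym_power_power: "f \<in> sym_power 1 \<Longrightarrow> f ^ n \<in> sym_power n"
proof (induction n)
  case 0
  then show ?case using bivariate_coeff_monomial[of 0 0] by (auto simp: sym_power_def split: if_splits)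
next
  case (Suc n)
  then show ?case using sym_power_mult[of f 1 "f ^ n" n] by simp
qed

lemma image_in_sym_power: "image_x U \<in> sym_power 1" "image_y U \<in> sym_power 1"
proof -
  have "sym_x \<in> sym_power 1" "sym_y \<in> sym_power 1"
    using bivariate_coeff_monomial[of 1 0] bivariate_coeff_monomial[of 0 1]
    by (auto simp: sym_power_def split: if_splits)
  then show "image_x U \<in> sym_power 1" "image_y U \<in> sym_power 1"
    by (auto simp: image_x_def image_y_def intro: sym_power_add sym_power_scale)
qed

lemma sym_action_monomial: "sym_action U (monomial_xy i j) = image_x U ^ i * image_y U ^ j"
  by (simp add: sym_action.hom_mult sym_action.hom_power sym_action_x sym_action_y)

lemma sym_action_expand:
  assumes "f \<in> sym_power n"
  shows "sym_action U f =
    (\<Sum>i\<le>n. bivariate_scale (bivariate_coeff f i (n - i)) (sym_action U (monomial_xy i (n - i))))"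
  by (subst sym_power_expand[OF assms]) (simp only: sym_action.hom_sum sym_action_scale)

lemma sym_action_in_sym_power:
  assumes "f \<in> sym_power n"
  shows "sym_action U f \<in> sym_power n"
proof -
  have "sym_action U (monomial_xy i (n - i)) \<in> sym_power n" if "i \<le> n" for i
    using sym_power_mult[OF sym_power_power sym_power_power, of "image_x U" "image_y U" i "n - i"]
      that image_in_sym_power by (simp add: sym_action_monomial)
  then show ?thesis
    unfolding sym_action_expand[OF assms] by (intro sym_power_sum sym_power_scale) auto
qed

lemma monomial_in_sym_power: "i \<le> n \<Longrightarrow> monomial_xy i (n - i) \<in> sym_power n"
  by (auto simp: sym_power_def bivariate_coeff_monomial split: if_splits)

text \<open>Both sides are multiplicative, so it suffices to compare them on \<open>x\<close> and \<open>y\<close>, where the identity is the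
definition of the matrix product.\<close>

lemma sym_action_mult:
  assumes U: "U \<in> carrier_mat 2 2" and V: "V \<in> carrier_mat 2 2" and f: "f \<in> sym_power n"
  shows "sym_action (U * V) f = sym_action U (sym_action V f)"
proof -
  have entry: "(U * V) $$ (i, j) = U $$ (i, 0) * V $$ (0, j) + U $$ (i, 1) * V $$ (1, j)"
    if "i < 2" "j < 2" for i j
    using that U V by (simp add: scalar_prod_def sum_below_2)
  have x: "sym_action U (image_x V) = image_x (U * V)"
    by (simp only: image_x_def sym_action.hom_add sym_action_scale sym_action_x sym_action_y)
      (simp add: entry image_x_def image_y_def smult_add_right bivariate_scale_add_left algebra_simps)
  have y: "sym_action U (image_y V) = image_y (U * V)"
    by (simp only: image_y_def sym_action.hom_add sym_action_scale sym_action_x sym_action_y)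
      (simp add: entry image_x_def image_y_def smult_add_right bivariate_scale_add_left algebra_simps)
  have "sym_action U (sym_action V (monomial_xy i j)) = sym_action (U * V) (monomial_xy i j)" for i j
    by (simp only: sym_action_monomial sym_action.hom_mult sym_action.hom_power sym_action_x sym_action_y x y)
  then show ?thesis
    by (simp only: sym_action_expand[OF f, of V] sym_action_expand[OF f, of "U * V"]
        sym_action.hom_sum sym_action_scale)
qed

text \<open>The matrix of the action on \<open>Sym\<^sup>n(\<complex>\<^sup>2)\<close> in the basis \<open>x\<^sup>i y\<^sup>n\<^sup>-\<^sup>i\<close>, \<open>i = 0, \<dots>, n\<close>.\<close>

definition sym_power_mat :: "nat \<Rightarrow> complex mat \<Rightarrow> complex mat" where
  "sym_power_mat n U = mat (Suc n) (Suc n)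
     (\<lambda>(i, j). bivariate_coeff (sym_action U (monomial_xy j (n - j))) i (n - i))"

lemma sym_power_mat_carrier [simp]: "sym_power_mat n U \<in> carrier_mat (Suc n) (Suc n)"
  by (simp add: sym_power_mat_def)

lemma sym_power_mat_mult:
  assumes U: "U \<in> carrier_mat 2 2" and V: "V \<in> carrier_mat 2 2"
  shows "sym_power_mat n (U * V) = sym_power_mat n U * sym_power_mat n V"
proof (rule eq_matI)
  fix i j assume "i < dim_row (sym_power_mat n U * sym_power_mat n V)" "j < dim_col (sym_power_mat n U * sym_power_mat n V)"
  then have i: "i \<le> n" and j: "j \<le> n" by (auto simp: sym_power_mat_def)
  have mon: "monomial_xy j (n - j) \<in> sym_power n" using monomial_in_sym_power[OF j] .
  have "sym_power_mat n (U * V) $$ (i, j) =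
      bivariate_coeff (sym_action U (sym_action V (monomial_xy j (n - j)))) i (n - i)"
    using i j sym_action_mult[OF U V mon] by (simp add: sym_power_mat_def)
  also have "\<dots> = (\<Sum>l\<le>n. sym_power_mat n U $$ (i, l) * sym_power_mat n V $$ (l, j))"
    unfolding sym_action_expand[OF sym_action_in_sym_power[OF mon], of U] coeff_sum
    using i j by (intro sum.cong) (auto simp: sym_power_mat_def)
  also have "\<dots> = (sym_power_mat n U * sym_power_mat n V) $$ (i, j)"
    using i j by (simp add: sym_power_mat_def scalar_prod_def atLeast0LessThan lessThan_Suc_atMost
        del: sum.lessThan_Suc sum.atMost_Suc)
  finally show "sym_power_mat n (U * V) $$ (i, j) = (sym_power_mat n U * sym_power_mat n V) $$ (i, j)" .
qed (auto simp: sym_power_mat_def)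

text \<open>For a triangular matrix with diagonal \<open>\<lambda>\<close>, \<open>\<mu>\<close> the image of \<open>x\<close> is \<open>\<lambda> x\<close>, so the monomial \<open>x\<^sup>i y\<^sup>j\<close>
occurs in its own image only through the term \<open>\<mu> y\<close> in the image of \<open>y\<close>.\<close>

lemma mat_trace_sym_power_triangular:
  assumes "B $$ (1, 0) = 0"
  shows "mat_trace (sym_power_mat n B) = (\<Sum>i\<le>n. B $$ (0, 0) ^ i * B $$ (1, 1) ^ (n - i))"
proof -
  have y: "bivariate_coeff (image_y B ^ m) 0 m = B $$ (1, 1) ^ m" for m
    by (induction m) (simp_all add: image_y_def sym_x_def sym_y_def coeff_mult_0)
  have "bivariate_coeff (sym_action B (monomial_xy i j)) i j = B $$ (0, 0) ^ i * B $$ (1, 1) ^ j" for i j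
  proof -
    have "image_x B ^ i = bivariate_scale (B $$ (0, 0) ^ i) (sym_x ^ i)"
      using assms by (simp add: image_x_def smult_power poly_const_pow)
    then have "sym_action B (monomial_xy i j) = smult (monom (B $$ (0, 0) ^ i) i) (image_y B ^ j)"
      unfolding sym_action_monomial by (simp add: sym_x_power smult_monom)
    then show ?thesis using y[of j] by (simp add: coeff_monom_mult)
  qed
  then show ?thesis
    by (simp add: mat_trace_def sym_power_mat_def lessThan_Suc_atMost del: sum.lessThan_Suc sum.atMost_Suc)
qed

text \<open>By Schur triangularization the trace is the complete homogeneous symmetric polynomial
\<open>h\<^sub>n(\<lambda>, \<mu>)\<close> in the eigenvalues, which satisfies \<open>(\<lambda> + \<mu>) h\<^sub>n = h\<^sub>n\<^sub>+\<^sub>1 + \<lambda> \<mu> h\<^sub>n\<^sub>-\<^sub>1\<close>. For \<open>n = 0\<close> the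
last term is absent.\<close>

lemma mat_trace_sym_power_recurrence:
  assumes U: "U \<in> carrier_mat 2 2"
  shows "mat_trace (sym_power_mat 0 U) = 1"
    and "mat_trace U * mat_trace (sym_power_mat n U) = mat_trace (sym_power_mat (Suc n) U) +
      (if n = 0 then 0 else det U * mat_trace (sym_power_mat (n - 1) U))"
proof -
  obtain es where "char_poly U = (\<Prod>a\<leftarrow>es. [:- a, 1:])"
    using char_poly_factorized[OF U] by blast
  then obtain B where B: "B \<in> carrier_mat 2 2" "upper_triangular B" "similar_mat U B"
    using schur_decomposition_exists[OF U] by blast
  then obtain P Q where "similar_mat_wit U B P Q" by (auto simp: similar_mat_def)
  note wit = similar_mat_witD2[OF U this]
  have PQ: "P \<in> carrier_mat 2 2" "Q \<in> carrier_mat 2 2" "Q * P = 1\<^sub>m 2" "U = P * B * Q"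
    using wit by auto
  have BQP: "Q * (P * B) = B"
    using PQ B(1) by (simp flip: assoc_mult_mat[of Q 2 2 P 2 B 2])
  have trU: "mat_trace U = B $$ (0, 0) + B $$ (1, 1)"
    using mat_trace_mult_commute[of "P * B" 2 2 Q] PQ B(1) BQP
    by (simp add: mat_trace_def lessThan_atLeast0 sum_below_2)
  have detU: "det U = B $$ (0, 0) * B $$ (1, 1)"
    using det_similar[OF B(3)] det_2x2[OF B(1)] B(1,2) by (simp add: upper_triangular_def)
  define h where "h n = (\<Sum>i\<le>n. B $$ (0, 0) ^ i * B $$ (1, 1) ^ (n - i))" for n
  have tr: "mat_trace (sym_power_mat n U) = h n" for n
  proof -
    have "mat_trace (sym_power_mat n U) = mat_trace (sym_power_mat n (P * B) * sym_power_mat n Q)"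
      unfolding PQ(4) sym_power_mat_mult[OF mult_carrier_mat[OF PQ(1) B(1)] PQ(2)] ..
    also have "\<dots> = mat_trace (sym_power_mat n Q * sym_power_mat n (P * B))"
      by (rule mat_trace_mult_commute[OF sym_power_mat_carrier sym_power_mat_carrier])
    also have "\<dots> = mat_trace (sym_power_mat n B)"
      using PQ B(1) BQP by (simp flip: sym_power_mat_mult)
    also have "\<dots> = h n"
      using mat_trace_sym_power_triangular[of B n] B(1,2) by (simp add: h_def upper_triangular_def)
    finally show ?thesis .
  qed
  have h_Suc: "h (Suc n) = B $$ (0, 0) ^ Suc n + B $$ (1, 1) * h n" for n
    by (simp add: h_def sum_distrib_left Suc_diff_le ac_simps)
  have h_0: "h 0 = 1" by (simp add: h_def)
  show "mat_trace (sym_power_mat 0 U) = 1" by (simp add: tr h_0)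
  show "mat_trace U * mat_trace (sym_power_mat n U) = mat_trace (sym_power_mat (Suc n) U) +
      (if n = 0 then 0 else det U * mat_trace (sym_power_mat (n - 1) U))"
    unfolding tr trU detU by (cases n) (simp_all add: h_0 h_Suc algebra_simps)
qed

lemma vector_space_bivariate_scale: "vector_space bivariate_scale"
  by unfold_locales (simp_all add: smult_add_right mult.commute flip: smult_add_left one_pCons)

context finite_SU2_group
begin

text \<open>Averaging over \<open>G\<close> is a projection of \<open>Sym\<^sup>n(\<complex>\<^sup>2)\<close> onto the invariants.\<close>

lemma dim_sym_invariants:
  "of_nat (vector_space.dim bivariate_scale (sym_invariants G n)) =
    (\<Sum>g\<in>G. mat_trace (sym_power_mat n g)) / of_nat (card G)"
proof -
  interpret bivariate: vector_space bivariate_scale by (rule vector_space_bivariate_scale)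
  define P where "P f = bivariate_scale (1 / of_nat (card G)) (\<Sum>g\<in>G. sym_action g f)" for f
  have "of_nat (vector_space.dim bivariate_scale (sym_invariants G n)) =
      (\<Sum>i\<le>n. bivariate_coeff (P (monomial_xy i (n - i))) i (n - i))"
  proof (rule bivariate.dim_eq_trace_projection[where c = "\<lambda>i f. bivariate_coeff f i (n - i)"
        and P = P and e = "\<lambda>i. monomial_xy i (n - i)"])
    show "bivariate.subspace (sym_invariants G n)"
      unfolding bivariate.subspace_def sym_invariants_def
      by (auto simp: sym_action.hom_add sym_action_scale intro: sym_power_add sym_power_scale)
    show "v = (\<Sum>i\<le>n. bivariate_scale (bivariate_coeff v i (n - i)) (monomial_xy i (n - i)))"
      if "v \<in> sym_invariants G n" for v
      using that by (intro sym_power_expand) (simp add: sym_invariants_def)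
    show "P (v + w) = P v + P w" for v w
      by (simp add: P_def sym_action.hom_add sum.distrib smult_add_right)
    show "P (bivariate_scale x v) = bivariate_scale x (P v)" for x v
      by (simp add: P_def sym_action_scale flip: bivariate.scale_sum_right)
    show "P v = v" if "v \<in> sym_invariants G n" for v
    proof -
      have "(\<Sum>g\<in>G. sym_action g v) = bivariate_scale (of_nat (card G)) v"
        using that by (simp add: sym_invariants_def of_nat_poly)
      then show ?thesis by (simp add: P_def)
    qed
    show "P (monomial_xy i (n - i)) \<in> sym_invariants G n" if "i \<in> {..n}" for i
    proof -
      let ?f = "monomial_xy i (n - i)"
      have f: "?f \<in> sym_power n" using that by (intro monomial_in_sym_power) simp
      have "sym_action h (P ?f) = P ?f" if h: "h \<in> G" for h
      proof -
        have "sym_action h (\<Sum>g\<in>G. sym_action g ?f) = (\<Sum>g\<in>G. sym_action (h * g) ?f)"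
          unfolding sym_action.hom_sum
          by (intro sum.cong refl sym_action_mult[OF _ _ f, symmetric] G_carrier h)
        also have "\<dots> = (\<Sum>g\<in>G. sym_action g ?f)" by (rule sum_translate[OF h])
        finally show ?thesis by (simp only: P_def sym_action_scale)
      qed
      moreover have "P ?f \<in> sym_power n"
        unfolding P_def by (intro sym_power_scale sym_power_sum sym_action_in_sym_power f)
      ultimately show ?thesis by (simp add: sym_invariants_def)
    qed
  qed simp_all
  also have "\<dots> = (\<Sum>i\<le>n. \<Sum>g\<in>G. sym_power_mat n g $$ (i, i)) / of_nat (card G)"
    by (simp add: P_def coeff_sum sym_power_mat_def sum_divide_distrib sum_distrib_left)
  also have "(\<Sum>i\<le>n. \<Sum>g\<in>G. sym_power_mat n g $$ (i, i)) = (\<Sum>g\<in>G. mat_trace (sym_power_mat n g))"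
    by (subst sum.swap) (simp add: mat_trace_def sym_power_mat_def lessThan_Suc_atMost
        del: sum.lessThan_Suc sum.atMost_Suc)
  finally show ?thesis .
qed

end

section \<open>The Poincare series\<close>

context finite_SU2_group
begin

text \<open>The dimension of the invariants of \<open>Sym\<^sup>n(\<complex>\<^sup>2) \<otimes> \<sigma>\<close>. Because \<open>\<sigma>\<close> is not dualized, the recurrence
below has \<open>A\<close> itself rather than its transpose as coefficient matrix.\<close>

definition sym_inner :: "(complex mat \<Rightarrow> complex mat) \<Rightarrow> nat \<Rightarrow> complex" where
  "sym_inner \<sigma> n = (\<Sum>g\<in>G. mat_trace (sym_power_mat n g) * mat_trace (\<sigma> g)) / of_nat (card G)"

lemma sym_inner_0:
  assumes "irreps_of G r d \<rho>" "k \<le> r"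
  shows "sym_inner (\<rho> k) 0 = (if k = 0 then 1 else 0)"
  using sum_mat_trace_irreps[OF assms]
  by (simp add: sym_inner_def mat_trace_sym_power_recurrence(1) G_carrier)

text \<open>Both sides average \<open>g \<mapsto> tr g * \<chi>\<^sub>n(g) * \<psi>\<^sub>k(g)\<close>: on the left \<open>tr g\<close> is absorbed into the character \<open>\<psi>\<^sub>k\<close>
of \<open>\<rho>\<^sub>k\<close> by the McKay decomposition, on the right into the character \<open>\<chi>\<^sub>n\<close> of the symmetric power.\<close>

lemma sym_inner_step:
  assumes "irreps_of G r d \<rho>" "mckay_multiplicities G r d \<rho> a" "k \<le> r"
  shows "(\<Sum>j\<le>r. of_nat (a k j) * sym_inner (\<rho> j) n) =
    sym_inner (\<rho> k) (Suc n) + (if n = 0 then 0 else sym_inner (\<rho> k) (n - 1))"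
proof -
  let ?\<chi> = "\<lambda>n g. mat_trace (sym_power_mat n g)"
  have det: "det g = 1" if "g \<in> G" for g using in_SU2 that by (auto simp: SU2_def)
  have "(\<Sum>j\<le>r. of_nat (a k j) * sym_inner (\<rho> j) n) =
      (\<Sum>j\<le>r. \<Sum>g\<in>G. ?\<chi> n g * (of_nat (a k j) * mat_trace (\<rho> j g))) / of_nat (card G)"
    unfolding sum_divide_distrib by (simp add: sym_inner_def sum_distrib_left sum_divide_distrib ac_simps)
  also have "(\<Sum>j\<le>r. \<Sum>g\<in>G. ?\<chi> n g * (of_nat (a k j) * mat_trace (\<rho> j g))) =
      (\<Sum>g\<in>G. ?\<chi> n g * (\<Sum>j\<le>r. of_nat (a k j) * mat_trace (\<rho> j g)))"
    by (subst sum.swap) (simp add: sum_distrib_left)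
  also have "\<dots> = (\<Sum>g\<in>G. (?\<chi> (Suc n) g + (if n = 0 then 0 else ?\<chi> (n - 1) g)) * mat_trace (\<rho> k g))"
  proof (rule sum.cong)
    fix g assume g: "g \<in> G"
    have "?\<chi> n g * (\<Sum>j\<le>r. of_nat (a k j) * mat_trace (\<rho> j g)) = (mat_trace g * ?\<chi> n g) * mat_trace (\<rho> k g)"
      using mckay_character[OF assms g] by (simp add: ac_simps flip: mckay_character[OF assms g])
    then show "?\<chi> n g * (\<Sum>j\<le>r. of_nat (a k j) * mat_trace (\<rho> j g)) =
        (?\<chi> (Suc n) g + (if n = 0 then 0 else ?\<chi> (n - 1) g)) * mat_trace (\<rho> k g)"
      using mat_trace_sym_power_recurrence(2)[OF G_carrier[OF g], of n] det[OF g] by simp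
  qed simp
  finally show ?thesis
    by (simp add: sym_inner_def ring_distribs sum.distrib add_divide_distrib)
qed

lemma sym_inner_trivial:
  assumes "irreps_of G r d \<rho>"
  shows "sym_inner (\<rho> 0) n = of_nat (vector_space.dim bivariate_scale (sym_invariants G n))"
  using assms unfolding dim_sym_invariants by (simp add: sym_inner_def irreps_of_def)

end

theorem theorem1p4:
  fixes G :: "complex mat set"
    and r :: nat and d :: "nat \<Rightarrow> nat" and \<rho> :: "nat \<Rightarrow> complex mat \<Rightarrow> complex mat"
    and a :: "nat \<Rightarrow> nat \<Rightarrow> nat" and C\<^sub>a C :: "real mat"
  assumes "binary_polyhedral G"
    and "irreps_of G r d \<rho>"
    and "mckay_multiplicities G r d \<rho> a"
    and "coxeter_transformation (affine_cartan_matrix r a) C\<^sub>a"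
    and "coxeter_transformation (cartan_matrix r a) C"
  shows "poincare_series_0 G = fps_of_poly (det_t2 C) / fps_of_poly (det_t2 C\<^sub>a)"
proof -
  interpret finite_SU2_group G
    using binary_polyhedral_group[OF assms(1)] by unfold_locales auto
  have minus: "- 1\<^sub>m 2 \<in> G" by (rule binary_polyhedral_group[OF assms(1)])
  have no_loop: "a k k = 0" if "k \<le> r" for k
    by (rule mckay_no_loop[OF minus assms(2,3) that])
  let ?K = "affine_cartan_matrix r a"
  have K: "?K \<in> carrier_mat (Suc r) (Suc r)" by (auto simp: affine_cartan_matrix_def)
  have K0: "cartan_matrix r a \<in> carrier_mat r r"
    using K by (auto simp: cartan_matrix_def mat_delete_def)
  have Ca: "det_t2 C\<^sub>a = det (quantum_cartan ?K)"
    by (rule det_t2_coxeter_transformation[OF K _ assms(4)]) (use no_loop in \<open>auto simp: affine_cartan_matrix_def\<close>)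
  have C: "det_t2 C = det (quantum_cartan (cartan_matrix r a))"
    by (rule det_t2_coxeter_transformation[OF K0 _ assms(5)])
      (use no_loop in \<open>auto simp: cartan_matrix_def affine_cartan_matrix_def mat_delete_def\<close>)
  define u where "u n k = Re (sym_inner (\<rho> k) n)" for n k
  have "fps_of_poly (det (quantum_cartan ?K)) * Abs_fps (\<lambda>n. u n 0) =
      fps_of_poly (det (quantum_cartan (cartan_matrix r a)))"
  proof (rule generating_function_quantum_cartan)
    show "a k k = 0" if "k \<le> r" for k by (rule no_loop[OF that])
    show "u 0 k = (if k = 0 then 1 else 0)" if "k \<le> r" for k
      using sym_inner_0[OF assms(2) that] by (simp add: u_def)
    show "(\<Sum>j\<le>r. real (a k j) * u n j) = u (Suc n) k + (if n = 0 then 0 else u (n - 1) k)"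
      if "k \<le> r" for n k
      using arg_cong[OF sym_inner_step[OF assms(2,3) that, of n], of Re] by (simp add: u_def)
  qed
  moreover have "Abs_fps (\<lambda>n. u n 0) = poincare_series_0 G"
    by (simp add: u_def sym_inner_trivial[OF assms(2)] poincare_series_0_def)
  ultimately have "fps_of_poly (det_t2 C\<^sub>a) * poincare_series_0 G = fps_of_poly (det_t2 C)"
    by (simp add: Ca C)
  moreover have "fps_of_poly (det_t2 C\<^sub>a) \<noteq> 0"
    by (simp add: Ca det_quantum_cartan_nonzero)
  ultimately show ?thesis
    by (metis nonzero_mult_div_cancel_left)
qed

end
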